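(* Let $\varphi$ be a non-elliptic automorphism of $\mathbb{D}$ in normalized form (hyperbolic with parameter $\alpha>1$, or parabolic with parameter $t>0$), let $J\subset\partial\mathbb{D}$ be the associated set, and let $\lambda>0$. In both the hyperbolic and the parabolic case, there is an outer function $$F(z)=\exp\left(\int_{-\pi}^{\pi}\frac{e^{i\theta}+z}{e^{i\theta}-z}\,\log f(e^{i\theta})\,\frac{d\theta}{2\pi}\right)\in H^\infty$$ (with $f\ge0$ on $\partial\mathbb{D}$, $f\in L^\infty(\partial\mathbb{D})$, $\log f\in L^1(\partial\mathbb{D})$) such that $F\circ\varphi=\gamma\lambda F$ for some $\gamma\in\partial\mathbb{D}$ if and only if $\lambda=1$; and the outer functions $F$ with this property are exactly those for which $f$ is (almost everywhere) of the form $$f(z)=\sum_{n\in\mathbb{Z}}\chi_{\varphi^{(n)}(J)}(z)\, f_0(\varphi^{(-n)}(z)),$$ where $f_0\ge0$ belongs to $L^\infty(J)$ and $\log f_0\in L^1(J)$.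
   Context: $\mathbb{D}$ is the open unit disc in $\mathbb{C}$ and $H^\infty$ is the space of bounded analytic functions on $\mathbb{D}$. For $n\in\mathbb{Z}$, $\varphi^{(n)}$ is the $|n|$-th iterate of $\varphi$ if $n>0$, of $\varphi^{-1}$ if $n<0$, and the identity if $n=0$. $L^\infty$ and $L^1$ are with respect to arc-length (Lebesgue) measure on $\partial\mathbb{D}$; $\chi_A$ is the characteristic function of $A$. Normalization: let $h(z)=i\frac{1+z}{1-z}$, which maps $\mathbb{D}$ conformally onto the upper half-plane $\mathbb{C}_+$, with $h^{-1}(v)=\frac{v-i}{v+i}$. The hyperbolic automorphism (fixed points $\pm1$, with $1$ attractive) is $\varphi=h^{-1}\circ\tilde\varphi\circ h$ with $\tilde\varphi(w)=\alpha w$, $\alpha>1$; the parabolic automorphism (fixed point $1$) is $\varphi=h^{-1}\circ\tilde\varphi\circ h$ with $\tilde\varphi(w)=w+t$, $t>0$. The set $J$: in the hyperbolic case, $J=(\varphi(i),i]\cup[-i,\varphi(-i))$, the union of two half-open circular arcs of $\partial\mathbb{D}$ not containing $\pm1$ (equivalently $h(J)=(-\alpha,-1]\cup[1,\alpha)$); in the parabolic case, $J=[-1,\varphi(-1))$, the half-open circular arc of $\partial\mathbb{D}$ not containing $1$ (equivalently $h(J)=[0,t)$). The sets $\varphi^{(n)}(J)$, $n\in\mathbb{Z}$, are pairwise disjoint and cover $\partial\mathbb{D}$ except for the fixed points of $\varphi$. *)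

theory Defs
  imports "HOL-Analysis.Analysis"
begin

subsection \<open>Normalized non-elliptic automorphisms of the disc\<close>

definition to_halfplane :: "complex \<Rightarrow> complex" where
  "to_halfplane z = \<i> * (1 + z) / (1 - z)"

definition of_halfplane :: "complex \<Rightarrow> complex" where
  "of_halfplane v = (v - \<i>) / (v + \<i>)"

text \<open>
  The point \<open>1\<close> corresponds to infinity in the half-plane model, which both model maps fix; it is
  treated separately because division by zero yields \<open>0\<close>. The maps below are only
  meaningful on the closed unit disc.
\<close>

definition disc_conj :: "(complex \<Rightarrow> complex) \<Rightarrow> complex \<Rightarrow> complex" where
  "disc_conj g z = (if z = 1 then 1 else of_halfplane (g (to_halfplane z)))"

definition hyp_aut :: "real \<Rightarrow> complex \<Rightarrow> complex" where
  "hyp_aut \<alpha> = disc_conj (\<lambda>w. of_real \<alpha> * w)"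

definition par_aut :: "real \<Rightarrow> complex \<Rightarrow> complex" where
  "par_aut t = disc_conj (\<lambda>w. w + of_real t)"

definition int_iter :: "(complex \<Rightarrow> complex) \<Rightarrow> int \<Rightarrow> complex \<Rightarrow> complex" where
  "int_iter \<phi> n =
     (if n \<ge> 0 then \<phi> ^^ nat n else inv_into (cball 0 1) \<phi> ^^ nat (- n))"

text \<open>
  The arcs are parametrized counterclockwise by the angle; note that \<open>Arg\<close> takes values in
  \<open>{-pi<..pi}\<close>, so the arc starting at \<open>-1\<close> starts at the angle \<open>-pi\<close>.
\<close>

definition hyp_J :: "real \<Rightarrow> complex set" where
  "hyp_J \<alpha> = cis ` {Arg (hyp_aut \<alpha> \<i>) <.. Arg \<i>}
            \<union> cis ` {Arg (- \<i>) ..< Arg (hyp_aut \<alpha> (- \<i>))}"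

definition par_J :: "real \<Rightarrow> complex set" where
  "par_J t = cis ` {- pi ..< Arg (par_aut t (- 1))}"


subsection \<open>Function spaces\<close>

definition H_inf :: "(complex \<Rightarrow> complex) set" where
  "H_inf = {F. F holomorphic_on ball 0 1 \<and> bounded (F ` ball 0 1)}"

definition arc_length :: "complex measure" where
  "arc_length = embed_measure (lebesgue_on {- pi <.. pi}) cis"

definition ess_bounded :: "complex measure \<Rightarrow> (complex \<Rightarrow> real) \<Rightarrow> bool" where
  "ess_bounded M f \<longleftrightarrow> f \<in> borel_measurable M \<and> (\<exists>C. AE x in M. \<bar>f x\<bar> \<le> C)"

text \<open>
  As \<open>ln 0 = 0\<close> in HOL whereas the logarithm of \<open>0\<close> is minus infinity,
  integrability of the logarithm has to include positivity almost everywhere.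
\<close>

definition log_integrable :: "complex measure \<Rightarrow> (complex \<Rightarrow> real) \<Rightarrow> bool" where
  "log_integrable M f \<longleftrightarrow> (AE x in M. f x > 0) \<and> integrable M (\<lambda>x. ln (f x))"

definition weight_on :: "complex set \<Rightarrow> (complex \<Rightarrow> real) \<Rightarrow> bool" where
  "weight_on A f \<longleftrightarrow> (\<forall>x\<in>A. f x \<ge> 0) \<and>
     ess_bounded (restrict_space arc_length A) f \<and>
     log_integrable (restrict_space arc_length A) f"

text \<open>
  The integral is taken over \<open>lebesgue\<close>, not \<open>lborel\<close>, because the weights are
  only assumed Lebesgue measurable.
\<close>

definition outer_fun :: "(complex \<Rightarrow> real) \<Rightarrow> complex \<Rightarrow> complex" where
  "outer_fun f z = exp (LINT \<theta>:{- pi..pi}|lebesgue.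
     (cis \<theta> + z) / (cis \<theta> - z) * of_real (ln (f (cis \<theta>))) / of_real (2 * pi))"

definition is_outer :: "(complex \<Rightarrow> real) \<Rightarrow> (complex \<Rightarrow> complex) \<Rightarrow> bool" where
  "is_outer f F \<longleftrightarrow>
     weight_on (sphere 0 1) f \<and> F \<in> H_inf \<and> (\<forall>z\<in>ball 0 1. F z = outer_fun f z)"

definition eigen_mod :: "(complex \<Rightarrow> complex) \<Rightarrow> real \<Rightarrow> (complex \<Rightarrow> complex) \<Rightarrow> bool" where
  "eigen_mod \<phi> \<mu> F \<longleftrightarrow>
     (\<exists>\<gamma>\<in>sphere 0 1. \<forall>z\<in>ball 0 1. F (\<phi> z) = \<gamma> * of_real \<mu> * F z)"

text \<open>
  The sets \<open>int_iter \<phi> n ` J\<close> are pairwise disjoint, so at each point at most one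
  term of the sum is nonzero, and only the values of \<open>f0\<close> on \<open>J\<close> matter.
\<close>

definition spread ::
  "(complex \<Rightarrow> complex) \<Rightarrow> complex set \<Rightarrow> (complex \<Rightarrow> real) \<Rightarrow> complex \<Rightarrow> real" where
  "spread \<phi> J f0 z =
     (\<Sum>\<^sub>\<infinity>n::int. indicator (int_iter \<phi> n ` J) z * f0 (int_iter \<phi> (- n) z))"


subsection \<open>Consistency with the half-plane picture\<close>

lemma space_arc_length: "space arc_length = sphere 0 1"
proof -
  have "z \<in> cis ` {- pi <.. pi}" if "norm z = 1" for z :: complex
  proof
    show "z = cis (Arg z)"
      using that by (subst cis_Arg) (auto simp: sgn_div_norm)
    show "Arg z \<in> {- pi <.. pi}"
      using Arg_bounded[of z] by auto
  qed
  then show ?thesis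
    by (auto simp: arc_length_def space_embed_measure)
qed

lemma of_halfplane_real: "of_halfplane (of_real x) = - cis (2 * arctan x)"
proof -
  let ?u = "arctan x"
  have c: "cos ?u > 0" using arctan_lbound[of x] arctan_ubound[of x] by (intro cos_gt_zero_pi) auto
  have x: "x = sin ?u / cos ?u" by (metis tan_arctan tan_def)
  have nz: "complex_of_real x + \<i> \<noteq> 0" by (simp add: complex_eq_iff)
  have "of_real x - \<i> = - \<i> * cis ?u / of_real (cos ?u)"
    using c by (subst x) (simp add: complex_eq_iff)
  moreover have "of_real x + \<i> = \<i> * cis (- ?u) / of_real (cos ?u)"
    using c by (subst x) (simp add: complex_eq_iff)
  ultimately have "of_halfplane (of_real x) = - (cis ?u / cis (- ?u))"
    using c by (simp add: of_halfplane_def)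
  then show ?thesis by (simp add: cis_divide)
qed

lemma Arg_of_halfplane_neg:
  assumes "x < 0" shows "Arg (of_halfplane (of_real x)) = 2 * arctan x + pi"
proof -
  have "of_halfplane (of_real x) = cis (2 * arctan x + pi)"
    by (simp add: of_halfplane_real cis_mult [symmetric])
  moreover have "2 * arctan x + pi \<in> {- pi <.. pi}"
    using assms arctan_lbound[of x] arctan_less_zero_iff[of x] pi_gt_zero
    unfolding greaterThanAtMost_iff by linarith
  ultimately show ?thesis by (simp add: Arg_cis)
qed

lemma Arg_of_halfplane_pos:
  assumes "x > 0" shows "Arg (of_halfplane (of_real x)) = 2 * arctan x - pi"
proof -
  have "of_halfplane (of_real x) = cis (2 * arctan x - pi)"
    by (simp add: of_halfplane_real cis_divide [symmetric])
  moreover have "2 * arctan x - pi \<in> {- pi <.. pi}"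
    using assms arctan_ubound[of x] zero_less_arctan_iff[of x] pi_gt_zero
    unfolding greaterThanAtMost_iff by linarith
  ultimately show ?thesis by (simp add: Arg_cis)
qed

lemma to_of_halfplane:
  assumes "v + \<i> \<noteq> 0" shows "to_halfplane (of_halfplane v) = v"
proof -
  have "1 + of_halfplane v = 2 * v / (v + \<i>)" "1 - of_halfplane v = 2 * \<i> / (v + \<i>)"
    using assms by (simp_all add: of_halfplane_def divide_simps)
  then show ?thesis
    using assms by (simp add: to_halfplane_def)
qed

lemma image_arctan:
  "(\<lambda>x. 2 * arctan x + c) ` {a <.. b} = {2 * arctan a + c <.. 2 * arctan b + c}"
  "(\<lambda>x. 2 * arctan x + c) ` {a ..< b} = {2 * arctan a + c ..< 2 * arctan b + c}"
proof -
  have ex: "\<exists>x. \<theta> = 2 * arctan x + c"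
    if "2 * arctan a + c \<le> \<theta>" "\<theta> \<le> 2 * arctan b + c" for \<theta>
  proof
    have "- (pi / 2) < (\<theta> - c) / 2" "(\<theta> - c) / 2 < pi / 2"
      using that arctan_lbound[of a] arctan_ubound[of b] by argo+
    then have "arctan (tan ((\<theta> - c) / 2)) = (\<theta> - c) / 2"
      by (intro arctan_tan) auto
    then show "\<theta> = 2 * arctan (tan ((\<theta> - c) / 2)) + c" by simp
  qed
  show "(\<lambda>x. 2 * arctan x + c) ` {a <.. b} = {2 * arctan a + c <.. 2 * arctan b + c}"
  proof safe
    fix \<theta> assume "\<theta> \<in> {2 * arctan a + c <.. 2 * arctan b + c}"
    with ex[of \<theta>] obtain x where "\<theta> = 2 * arctan x + c" "a < x" "x \<le> b"
      by (auto simp: arctan_less_iff arctan_le_iff)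
    then show "\<theta> \<in> (\<lambda>x. 2 * arctan x + c) ` {a <.. b}" by auto
  qed (auto simp: arctan_less_iff arctan_le_iff)
  show "(\<lambda>x. 2 * arctan x + c) ` {a ..< b} = {2 * arctan a + c ..< 2 * arctan b + c}"
  proof safe
    fix \<theta> assume "\<theta> \<in> {2 * arctan a + c ..< 2 * arctan b + c}"
    with ex[of \<theta>] obtain x where "\<theta> = 2 * arctan x + c" "a \<le> x" "x < b"
      by (auto simp: arctan_less_iff arctan_le_iff)
    then show "\<theta> \<in> (\<lambda>x. 2 * arctan x + c) ` {a ..< b}" by auto
  qed (auto simp: arctan_less_iff arctan_le_iff)
qed

lemma to_halfplane_cis_arctan:
  assumes "c = pi \<or> c = - pi"
  shows "to_halfplane (cis (2 * arctan x + c)) = of_real x"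
proof -
  have "cis (2 * arctan x + c) = of_halfplane (of_real x)"
    using assms cis_mult[of "2 * arctan x" pi, symmetric] cis_divide[of "2 * arctan x" pi, symmetric]
    by (auto simp: of_halfplane_real)
  moreover have "complex_of_real x + \<i> \<noteq> 0" by (simp add: complex_eq_iff)
  ultimately show ?thesis by (simp add: to_of_halfplane)
qed

lemma to_halfplane_arc:
  assumes "c = pi \<or> c = - pi"
  shows "to_halfplane ` cis ` {2 * arctan a + c <.. 2 * arctan b + c} = of_real ` {a <.. b}"
    and "to_halfplane ` cis ` {2 * arctan a + c ..< 2 * arctan b + c} = of_real ` {a ..< b}"
  unfolding image_arctan [symmetric] image_image to_halfplane_cis_arctan [OF assms] by auto

lemma to_halfplane_hyp_J:
  assumes "\<alpha> > 1"
  shows "to_halfplane ` hyp_J \<alpha> = of_real ` ({- \<alpha> <.. - 1} \<union> {1 ..< \<alpha>})"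
proof -
  have "to_halfplane \<i> = of_real (- 1)" "to_halfplane (- \<i>) = of_real 1"
    by (simp_all add: to_halfplane_def complex_eq_iff Re_divide Im_divide power2_eq_square)
  moreover have "- \<i> \<noteq> 1" by (simp add: complex_eq_iff)
  ultimately have "hyp_aut \<alpha> \<i> = of_halfplane (of_real (- \<alpha>))" "hyp_aut \<alpha> (- \<i>) = of_halfplane (of_real \<alpha>)"
    by (auto simp: hyp_aut_def disc_conj_def)
  then have "Arg (hyp_aut \<alpha> \<i>) = 2 * arctan (- \<alpha>) + pi" "Arg (hyp_aut \<alpha> (- \<i>)) = 2 * arctan \<alpha> + - pi"
    using assms by (simp_all only: Arg_of_halfplane_neg Arg_of_halfplane_pos)
  moreover have "Arg \<i> = 2 * arctan (- 1) + pi" "Arg (- \<i>) = 2 * arctan 1 + - pi"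
    by (simp_all add: arctan_one arctan_minus)
  ultimately show ?thesis
    unfolding hyp_J_def by (simp only: image_Un to_halfplane_arc [where c = pi] to_halfplane_arc [where c = "- pi"] simp_thms)
qed

lemma to_halfplane_par_J:
  assumes "t > 0"
  shows "to_halfplane ` par_J t = of_real ` {0 ..< t}"
proof -
  have "par_aut t (- 1) = of_halfplane (of_real t)"
    by (simp add: par_aut_def disc_conj_def to_halfplane_def)
  then have "Arg (par_aut t (- 1)) = 2 * arctan t + - pi"
    using assms by (simp add: Arg_of_halfplane_pos)
  moreover have "- pi = 2 * arctan 0 + - pi" by simp
  ultimately show ?thesis
    unfolding par_J_def using to_halfplane_arc(2)[of "- pi" 0 t] by simp
qed

end

theory Submission
  imports Defs "HOL-Complex_Analysis.Complex_Analysis"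
begin

text \<open>
  Transported by \<open>line_pt x = of_halfplane x\<close>, the circle without the point \<open>1\<close> becomes the real line,
  arc length becomes the measure with density \<open>2 / (1 + x\<^sup>2)\<close>, and the automorphism acts as
  \<open>x \<mapsto> a x + b\<close> with \<open>b = 0\<close> (hyperbolic case) or \<open>a = 1\<close> (parabolic case). On the disc,
  \<open>ln |F|\<close> is the Poisson integral \<open>U\<close> of \<open>u x = ln (f (line_pt x))\<close> over the line.

  The equation \<open>F \<circ> \<phi> = \<gamma> lam F\<close> gives \<open>|F (\<phi>\<^sup>n z)| = lam\<^sup>n |F z|\<close> for positive and negative \<open>n\<close>.
  As \<open>F\<close> is bounded and has no zeros, \<open>lam = 1\<close>. For \<open>lam = 1\<close> the equation is equivalent to
  \<open>|F \<circ> \<phi>| = |F|\<close>, since the quotient \<open>F \<circ> \<phi> / F\<close> is holomorphic and, by the maximum modulus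
  principle, constant as soon as its modulus is \<open>1\<close>. The Poisson kernel is covariant under real
  affine maps (\<open>poisson_affine\<close>), so \<open>|F \<circ> \<phi>| = |F|\<close> says that \<open>u\<close> and \<open>x \<mapsto> u (a x + b)\<close> have the same
  Poisson integral. A function is determined almost everywhere by its Poisson integral
  (\<open>poisson_unique\<close>); hence \<open>f (line_pt (a x + b)) = f (line_pt x)\<close> for almost every \<open>x\<close>
  (\<open>eigen_outer_iff_invariant\<close>).

  The set \<open>J\<close> corresponds to a fundamental domain of this action, so an invariant \<open>f\<close> is the same thing
  as a function on \<open>J\<close> spread along the orbits (\<open>invariant_iff_spread\<close>). What remains is that spreading
  an admissible weight on \<open>J\<close> yields an admissible weight on the circle. Positivity and boundedness
  carry over from tile to tile. For the integrability of the logarithm, the \<open>n\<close>-th tile contributes at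
  most \<open>\<kappa>\<close> times the integral over \<open>J\<close>, with \<open>\<kappa>\<close> decaying geometrically in \<open>|n|\<close> in the hyperbolic case
  and like \<open>1 / n\<^sup>2\<close> in the parabolic one, so that the contributions can be summed
  (\<open>spread_integrable\<close>).
\<close>

section \<open>The unit circle seen from the real line\<close>

definition line_pt :: "real \<Rightarrow> complex" where
  "line_pt x = of_halfplane (of_real x)"

text \<open>
  The density of arc length in the coordinate \<open>x\<close>: the derivative of the angle \<open>2 arctan x \<plusminus> pi\<close>.
\<close>

definition line_wt :: "real \<Rightarrow> real" where
  "line_wt x = 2 / (1 + x\<^sup>2)"

text \<open>
  A branch of the argument of \<open>line_pt x\<close> with values in \<open>[-pi, pi]\<close>. It jumps at \<open>x = 0\<close>, which
  corresponds to the point \<open>-1\<close> where \<open>Arg\<close> is discontinuous; this is why \<open>0\<close> is removed below.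
\<close>

definition line_ang :: "real \<Rightarrow> real" where
  "line_ang x = 2 * arctan x + (if x < 0 then pi else - pi)"

lemma line_wt_pos: "line_wt x > 0"
  unfolding line_wt_def by (simp add: add_pos_nonneg)

lemma cis_line_ang: "cis (line_ang x) = line_pt x"
  using cis_divide[of "2 * arctan x" pi] cis_mult[of "2 * arctan x" pi]
  by (auto simp: line_pt_def line_ang_def of_halfplane_real)

lemma line_ang_image: "line_ang ` (- {0}) = {- pi <..< pi} - {0}"
proof (intro equalityI subsetI)
  fix \<theta> assume "\<theta> \<in> line_ang ` (- {0})"
  then obtain x where x: "x \<noteq> 0" "\<theta> = line_ang x" by auto
  have b: "- (pi / 2) < arctan x" "arctan x < pi / 2"
    by (rule arctan_lbound, rule arctan_ubound)
  have "- pi < \<theta> \<and> \<theta> < pi \<and> \<theta> \<noteq> 0"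
  proof (cases "x < 0")
    case True
    then have "arctan x < 0" by simp
    moreover have "\<theta> = 2 * arctan x + pi" using True x by (simp add: line_ang_def)
    ultimately show ?thesis using b pi_gt_zero by linarith
  next
    case False
    with x have "arctan x > 0" by simp
    moreover have "\<theta> = 2 * arctan x - pi" using False x by (simp add: line_ang_def)
    ultimately show ?thesis using b pi_gt_zero by linarith
  qed
  then show "\<theta> \<in> {- pi <..< pi} - {0}" by simp
next
  fix \<theta> assume th: "\<theta> \<in> {- pi <..< pi} - {0}"
  define y where "y = (if \<theta> > 0 then (\<theta> - pi) / 2 else (\<theta> + pi) / 2)"
  have y: "- (pi / 2) < y" "y < pi / 2" "\<theta> > 0 \<longleftrightarrow> y < 0" "y \<noteq> 0"
    using th unfolding y_def by (simp_all split: if_splits)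
  have a: "arctan (tan y) = y" using y by (intro arctan_tan) auto
  have t: "tan y < 0 \<longleftrightarrow> y < 0" "tan y \<noteq> 0"
    using arctan_less_zero_iff[of "tan y"] arctan_eq_zero_iff[of "tan y"] y(4) unfolding a by simp_all
  show "\<theta> \<in> line_ang ` (- {0})"
  proof
    show "\<theta> = line_ang (tan y)" using y(3) t(1) by (simp add: line_ang_def a) (simp add: y_def field_simps)
    show "tan y \<in> - {0}" using t by simp
  qed
qed

lemma line_ang_inj: "inj_on line_ang (- {0})"
proof (rule inj_onI)
  fix x y assume xy: "x \<in> - {0}" "y \<in> - {0}" "line_ang x = line_ang y"
  have "arctan x = arctan y"
    using xy(3) arctan_lbound[of x] arctan_ubound[of x] arctan_lbound[of y] arctan_ubound[of y]
    unfolding line_ang_def by (simp split: if_splits)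
  then show "x = y" by (metis tan_arctan)
qed

lemma line_ang_deriv:
  assumes "x \<in> - {0}"
  shows "(line_ang has_field_derivative line_wt x) (at x within - {0})"
proof -
  have *: "((\<lambda>x. 2 * arctan x + c) has_field_derivative line_wt x) (at x)" for c
    unfolding line_wt_def by (auto intro!: derivative_eq_intros simp: divide_simps)
  have "(line_ang has_field_derivative line_wt x) (at x)"
  proof (cases "x < 0")
    case True
    then have "\<forall>\<^sub>F y in nhds x. line_ang y = 2 * arctan y + pi"
      by (intro eventually_nhds_in_open[of "{..<0}", THEN eventually_mono]) (auto simp: line_ang_def)
    then show ?thesis using *[of pi] by (subst DERIV_cong_ev) auto
  next
    case False
    then have "\<forall>\<^sub>F y in nhds x. line_ang y = 2 * arctan y + - pi"
      using assms by (intro eventually_nhds_in_open[of "{0<..}", THEN eventually_mono]) (auto simp: line_ang_def)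
    then show ?thesis using *[of "- pi"] by (subst DERIV_cong_ev) auto
  qed
  then show ?thesis by (rule DERIV_subset) simp
qed

lemma cis_inj: "inj_on cis {- pi <.. pi}"
  by (rule inj_onI) (metis Arg_cis greaterThanAtMost_iff)

lemma integrable_lebesgue_spike:
  fixes f :: "real \<Rightarrow> 'a :: euclidean_space"
  assumes "finite (S - T)" "finite (T - S)" "S \<in> sets lebesgue" "T \<in> sets lebesgue"
  shows "set_integrable lebesgue S f \<longleftrightarrow> set_integrable lebesgue T f"
    and "(LINT x:S|lebesgue. f x) = (LINT x:T|lebesgue. f x)"
proof -
  have "AE x in lebesgue. x \<notin> (S - T) \<union> (T - S)"
    using assms(1,2) by (intro AE_not_in) (auto intro!: negligible_finite simp flip: negligible_iff_null_sets)
  then have ae: "AE x in lebesgue. indicator S x *\<^sub>R f x = indicator T x *\<^sub>R f x"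
    by eventually_elim (auto simp: indicator_def)
  have me: "(\<lambda>x. indicator S x *\<^sub>R f x) \<in> borel_measurable lebesgue \<longleftrightarrow> (\<lambda>x. indicator T x *\<^sub>R f x) \<in> borel_measurable lebesgue"
  proof
    assume "(\<lambda>x. indicator S x *\<^sub>R f x) \<in> borel_measurable lebesgue"
    then show "(\<lambda>x. indicator T x *\<^sub>R f x) \<in> borel_measurable lebesgue"
      using ae by (rule borel_measurable_AE)
  next
    assume "(\<lambda>x. indicator T x *\<^sub>R f x) \<in> borel_measurable lebesgue"
    then show "(\<lambda>x. indicator S x *\<^sub>R f x) \<in> borel_measurable lebesgue"
      by (rule borel_measurable_AE) (use ae in \<open>eventually_elim, auto\<close>)
  qed
  show 1: "set_integrable lebesgue S f \<longleftrightarrow> set_integrable lebesgue T f"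
    unfolding set_integrable_def
    using integrable_cong_AE[OF _ _ ae] me borel_measurable_integrable by blast
  show "(LINT x:S|lebesgue. f x) = (LINT x:T|lebesgue. f x)"
  proof (cases "set_integrable lebesgue S f")
    case True
    with 1 show ?thesis unfolding set_lebesgue_integral_def set_integrable_def
      using ae by (intro integral_cong_AE) auto
  next
    case False
    with 1 show ?thesis unfolding set_lebesgue_integral_def set_integrable_def
      by (auto simp: not_integrable_integral_eq)
  qed
qed

lemma arc_length_integrable:
  fixes k :: "complex \<Rightarrow> 'a :: euclidean_space"
  shows "integrable arc_length k \<longleftrightarrow> set_integrable lebesgue {- pi..pi} (\<lambda>\<theta>. k (cis \<theta>))"
    and "integral\<^sup>L arc_length k = (LINT \<theta>:{- pi..pi}|lebesgue. k (cis \<theta>))"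
proof -
  let ?M = "lebesgue_on {- pi <.. pi}"
  have inj: "inj_on cis (space ?M)" using cis_inj by simp
  have cm: "cis \<in> measurable ?M arc_length"
    unfolding arc_length_def by (rule measurable_embed_measure2'[OF inj])
  have di: "arc_length = distr ?M arc_length cis"
    unfolding arc_length_def by (rule embed_measure_eq_distr'[OF inj])
  have m: "k \<in> borel_measurable arc_length" if "(\<lambda>\<theta>. k (cis \<theta>)) \<in> borel_measurable ?M"
    unfolding arc_length_def using that by (rule measurable_embed_measure1[where g = k])
  have 0: "integrable arc_length k \<longleftrightarrow> integrable ?M (\<lambda>\<theta>. k (cis \<theta>))"
    using integrable_distr_eq[OF cm, of k] m borel_measurable_integrable di by metis
  have f: "{- pi..pi} - {- pi<..pi} = {-pi}" "{- pi<..pi} - {- pi..pi} = {}" using pi_gt_zero by auto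
  have sp: "set_integrable lebesgue {- pi<..pi} g \<longleftrightarrow> set_integrable lebesgue {- pi..pi} g"
    "(LINT x:{- pi<..pi}|lebesgue. g x) = (LINT x:{- pi..pi}|lebesgue. g x)" for g :: "real \<Rightarrow> 'a"
    using integrable_lebesgue_spike[of "{- pi<..pi}" "{- pi..pi}" g] f by auto
  have r: "integrable ?M g \<longleftrightarrow> set_integrable lebesgue {- pi<..pi} g" for g :: "real \<Rightarrow> 'a"
    unfolding set_integrable_def by (intro integrable_restrict_space) auto
  have r2: "integral\<^sup>L ?M g = (LINT x:{- pi<..pi}|lebesgue. g x)" for g :: "real \<Rightarrow> 'a"
    unfolding set_lebesgue_integral_def by (intro integral_restrict_space) auto
  show 1: "integrable arc_length k \<longleftrightarrow> set_integrable lebesgue {- pi..pi} (\<lambda>\<theta>. k (cis \<theta>))"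
    using 0 r sp by simp
  show "integral\<^sup>L arc_length k = (LINT \<theta>:{- pi..pi}|lebesgue. k (cis \<theta>))"
  proof (cases "integrable arc_length k")
    case True
    then have "k \<in> borel_measurable arc_length" by simp
    then have "integral\<^sup>L arc_length k = integral\<^sup>L ?M (\<lambda>\<theta>. k (cis \<theta>))"
      using integral_distr[OF cm, of k] di by metis
    then show ?thesis using r2 sp by simp
  next
    case False
    with 1 show ?thesis by (auto simp: not_integrable_integral_eq set_lebesgue_integral_def set_integrable_def)
  qed
qed

text \<open>
  Change of variables \<open>\<theta> = line_ang x\<close>. The finitely many angles that are not attained are null.
  Measurability, null sets and integrability on the circle are all reduced to the line by this lemma.
\<close>

lemma arc_length_line:
  fixes k :: "complex \<Rightarrow> real"
  shows "integrable arc_length k \<longleftrightarrow> integrable lebesgue (\<lambda>x. line_wt x * k (line_pt x))"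
    and "integral\<^sup>L arc_length k = (LINT x|lebesgue. line_wt x * k (line_pt x))"
proof -
  let ?S = "- {0::real}" and ?B = "{- pi <..< pi} - {0}"
  let ?g = "\<lambda>x. line_wt x * k (line_pt x)"
  have S: "?S \<in> sets lebesgue" by simp
  have eq: "\<bar>line_wt x\<bar> * k (cis (line_ang x)) = ?g x" for x
    using line_wt_pos[of x] by (simp add: cis_line_ang)
  have cv: "?g absolutely_integrable_on ?S \<and> integral ?S ?g = b
     \<longleftrightarrow> (\<lambda>\<theta>. k (cis \<theta>)) absolutely_integrable_on ?B \<and> integral ?B (\<lambda>\<theta>. k (cis \<theta>)) = b" for b
    using has_absolute_integral_change_of_variables_1'[OF S line_ang_deriv line_ang_inj, of "\<lambda>\<theta>. k (cis \<theta>)" b]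
    unfolding eq line_ang_image by auto
  have f: "finite ({- pi..pi} - ?B)" "finite (?B - {- pi..pi})"
  proof -
    have "{- pi..pi} - ?B \<subseteq> {-pi, 0, pi}" by auto
    then show "finite ({- pi..pi} - ?B)" by (rule finite_subset) simp
  qed (auto intro: finite_subset[of _ "{}"])
  have u: "(UNIV :: real set) - ?S = {0}" "?S - UNIV = {}" by auto
  have s1: "set_integrable lebesgue {- pi..pi} h \<longleftrightarrow> set_integrable lebesgue ?B h"
    "(LINT x:{- pi..pi}|lebesgue. h x) = (LINT x:?B|lebesgue. h x)" for h :: "real \<Rightarrow> real"
    using integrable_lebesgue_spike[OF f, of h] by auto
  have s2: "set_integrable lebesgue UNIV h \<longleftrightarrow> set_integrable lebesgue ?S h"
    "(LINT x:UNIV|lebesgue. h x) = (LINT x:?S|lebesgue. h x)" for h :: "real \<Rightarrow> real"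
    using integrable_lebesgue_spike[of UNIV ?S h] u by auto
  have s3: "set_integrable lebesgue UNIV h \<longleftrightarrow> integrable lebesgue h"
    "(LINT x:UNIV|lebesgue. h x) = (LINT x|lebesgue. h x)" for h :: "real \<Rightarrow> real"
    by (simp_all add: set_integrable_def set_lebesgue_integral_def)
  show 1: "integrable arc_length k \<longleftrightarrow> integrable lebesgue ?g"
    using cv s1 s2 s3 arc_length_integrable[of k] by auto
  show "integral\<^sup>L arc_length k = (LINT x|lebesgue. ?g x)"
  proof (cases "integrable arc_length k")
    case True
    then have "set_integrable lebesgue ?B (\<lambda>\<theta>. k (cis \<theta>))" "set_integrable lebesgue ?S ?g"
      using 1 s1 s2 s3 arc_length_integrable[of k] by auto
    then have "integral ?S ?g = (LINT x:?S|lebesgue. ?g x)"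
      "integral ?B (\<lambda>\<theta>. k (cis \<theta>)) = (LINT \<theta>:?B|lebesgue. k (cis \<theta>))"
      by (simp_all add: set_lebesgue_integral_eq_integral(2))
    then show ?thesis using cv \<open>set_integrable lebesgue ?B _\<close> s1 s2 s3 arc_length_integrable[of k] by metis
  next
    case False
    with 1 show ?thesis by (simp add: not_integrable_integral_eq)
  qed
qed

lemma line_pt_inj: "inj line_pt"
proof (rule injI)
  fix x y assume "line_pt x = line_pt y"
  moreover have "complex_of_real z + \<i> \<noteq> 0" for z by (simp add: complex_eq_iff)
  ultimately have "complex_of_real x = complex_of_real y"
    unfolding line_pt_def by (metis to_of_halfplane)
  then show "x = y" by simp
qed

lemma norm_line_pt: "norm (line_pt x) = 1"
  by (metis cis_line_ang norm_cis)

lemma line_pt_neq_1: "line_pt x \<noteq> 1"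
proof
  assume "line_pt x = 1"
  then have "of_real x - \<i> = of_real x + \<i>"
    unfolding line_pt_def of_halfplane_def by (auto simp: divide_simps split: if_splits)
  then show False by (auto simp: complex_eq_iff)
qed

lemma of_to_halfplane: "z \<noteq> 1 \<Longrightarrow> of_halfplane (to_halfplane z) = z"
proof -
  assume z: "z \<noteq> 1"
  then have "to_halfplane z - \<i> = 2 * \<i> * z / (1 - z)" "to_halfplane z + \<i> = 2 * \<i> / (1 - z)"
    by (simp_all add: to_halfplane_def field_simps)
  then show ?thesis using z by (simp add: of_halfplane_def)
qed

lemma Im_to_halfplane: "Im (to_halfplane z) = (1 - (norm z)\<^sup>2) / (norm (1 - z))\<^sup>2"
proof -
  have "Im (to_halfplane z) = (1 - ((Re z)\<^sup>2 + (Im z)\<^sup>2)) / ((1 - Re z)\<^sup>2 + (Im z)\<^sup>2)"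
    unfolding to_halfplane_def by (simp add: Im_divide power2_eq_square algebra_simps)
  then show ?thesis by (simp add: cmod_power2)
qed

lemma arc_length_integrable_one: "integrable arc_length (\<lambda>_. 1 :: real)"
  unfolding arc_length_integrable(1) by (auto simp: set_integrable_def intro!: integrable_completion)

lemma line_wt_integrable: "integrable lebesgue line_wt"
  using arc_length_line(1)[of "\<lambda>_. 1"] arc_length_integrable_one by simp

lemma line_wt_integral: "(LINT x|lebesgue. line_wt x) = 2 * pi"
proof -
  have "(LINT x|lebesgue. line_wt x) = (LINT \<theta>:{- pi..pi}|lebesgue. (1::real))"
    using arc_length_line(2)[of "\<lambda>_. 1"] arc_length_integrable(2)[of "\<lambda>_. 1 :: real"] by simp
  also have "\<dots> = 2 * pi" by (simp add: set_lebesgue_integral_def)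
  finally show ?thesis .
qed

text \<open>
  Arc length is finite, so a set is measurable exactly if its indicator is integrable, and null
  exactly if in addition the integral vanishes. Both properties transfer by \<open>arc_length_line\<close>.
\<close>

lemma arc_length_indicator:
  "A \<inter> sphere 0 1 \<in> sets arc_length \<longleftrightarrow> (line_pt -` A) \<in> sets lebesgue"
  "A \<inter> sphere 0 1 \<in> null_sets arc_length \<longleftrightarrow> (line_pt -` A) \<in> null_sets lebesgue"
proof -
  have fin: "emeasure arc_length B < \<infinity>" if "B \<in> sets arc_length" for B
  proof -
    have "integrable arc_length (\<lambda>x. indicator B x :: real)"
      by (rule Bochner_Integration.integrable_bound[OF arc_length_integrable_one]) (use that in \<open>auto simp: indicator_def\<close>)
    then show ?thesis
      using that sets.sets_into_space[OF that] by (simp add: integrable_indicator_iff Int_absorb2)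
  qed
  let ?w = "\<lambda>x. line_wt x * indicator (line_pt -` A) x"
  have 1: "A \<inter> sphere 0 1 \<in> sets arc_length \<longleftrightarrow> integrable arc_length (indicator A :: complex \<Rightarrow> real)"
    using fin[of "A \<inter> sphere 0 1"] by (auto simp: integrable_indicator_iff space_arc_length)
  also have "\<dots> \<longleftrightarrow> integrable lebesgue ?w"
    unfolding arc_length_line by (simp add: indicator_def)
  also have "\<dots> \<longleftrightarrow> (line_pt -` A) \<in> sets lebesgue"
  proof
    assume "integrable lebesgue ?w"
    then have "?w \<in> borel_measurable lebesgue" by simp
    then have "{x \<in> space lebesgue. ?w x \<noteq> 0} \<in> sets lebesgue" by measurable
    also have "{x \<in> space lebesgue. ?w x \<noteq> 0} = line_pt -` A"
      using line_wt_pos by (auto simp: indicator_def split: if_splits) (metis less_numeral_extra(3))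
    finally show "(line_pt -` A) \<in> sets lebesgue" .
  next
    assume "(line_pt -` A) \<in> sets lebesgue"
    then show "integrable lebesgue ?w"
      using line_wt_integrable by (intro integrable_real_mult_indicator) auto
  qed
  finally show 2: "A \<inter> sphere 0 1 \<in> sets arc_length \<longleftrightarrow> (line_pt -` A) \<in> sets lebesgue" .
  show "A \<inter> sphere 0 1 \<in> null_sets arc_length \<longleftrightarrow> (line_pt -` A) \<in> null_sets lebesgue"
  proof (cases "(line_pt -` A) \<in> sets lebesgue")
    case True
    then have i: "integrable lebesgue ?w" "integrable arc_length (indicator A :: complex \<Rightarrow> real)"
      and s: "A \<inter> sphere 0 1 \<in> sets arc_length"
      using 1 2 arc_length_line[of "indicator A"] by (auto simp: indicator_def)
    have "A \<inter> sphere 0 1 \<in> null_sets arc_length \<longleftrightarrow> integral\<^sup>L arc_length (indicator A :: complex \<Rightarrow> real) = 0"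
      using s fin[OF s] by (auto simp: null_sets_def space_arc_length emeasure_eq_ennreal_measure)
    also have "\<dots> \<longleftrightarrow> (LINT x|lebesgue. ?w x) = 0"
      unfolding arc_length_line by (simp add: indicator_def)
    also have "\<dots> \<longleftrightarrow> (AE x in lebesgue. ?w x = 0)"
      using line_wt_pos by (intro integral_nonneg_eq_0_iff_AE i) (auto simp: less_imp_le)
    also have "\<dots> \<longleftrightarrow> (AE x in lebesgue. x \<notin> line_pt -` A)"
      using line_wt_pos by (intro AE_cong) (auto simp: indicator_def less_le)
    also have "\<dots> \<longleftrightarrow> (line_pt -` A) \<in> null_sets lebesgue"
      using True by (subst AE_iff_null_sets) auto
    finally show ?thesis .
  qed (use 2 in auto)
qed

lemma arc_length_AE: "(AE z in arc_length. P z) \<longleftrightarrow> (AE x in lebesgue. P (line_pt x))"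
proof
  assume "AE z in arc_length. P z"
  then obtain N where N: "N \<in> null_sets arc_length" "{z \<in> space arc_length. \<not> P z} \<subseteq> N"
    by (auto elim!: AE_E simp: null_sets_def)
  then have "N \<subseteq> sphere 0 1" using null_setsD2 sets.sets_into_space space_arc_length by metis
  then have "N \<inter> sphere 0 1 = N" by auto
  then have "line_pt -` N \<in> null_sets lebesgue" using arc_length_indicator(2)[of N] N by simp
  then show "AE x in lebesgue. P (line_pt x)"
    by (rule AE_I') (use N(2) norm_line_pt in \<open>auto simp: space_arc_length subset_iff\<close>)
next
  assume "AE x in lebesgue. P (line_pt x)"
  then have "{x. \<not> P (line_pt x)} \<in> null_sets lebesgue"
    by (simp add: completion.AE_iff_null_sets)
  then have "line_pt -` ({1} \<union> {z. \<not> P z}) \<in> null_sets lebesgue"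
    by (simp add: vimage_def line_pt_neq_1)
  then have "({1} \<union> {z. \<not> P z}) \<inter> sphere 0 1 \<in> null_sets arc_length"
    by (subst arc_length_indicator)
  then show "AE z in arc_length. P z"
    by (rule AE_I') (auto simp: space_arc_length)
qed

section \<open>Outer functions and Poisson integrals\<close>

lemma borel_measurable_arc_length:
  assumes "g \<in> borel_measurable borel"
  shows "g \<in> borel_measurable arc_length"
proof -
  have "(\<lambda>\<theta>. g (cis \<theta>)) \<in> borel_measurable borel"
    by (rule measurable_compose[OF _ assms]) (intro borel_measurable_continuous_onI continuous_intros)
  then have "(\<lambda>\<theta>. g (cis \<theta>)) \<in> borel_measurable (lebesgue_on {- pi <.. pi})"
    by (intro measurable_restrict_space1 measurable_completion) simp
  then show ?thesis
    unfolding arc_length_def by (rule measurable_embed_measure1[where g = g])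
qed

lemma restrict_space_arc_length: "restrict_space arc_length (sphere 0 1) = arc_length"
proof (rule measure_eqI)
  show s: "sets (restrict_space arc_length (sphere 0 1)) = sets arc_length"
    unfolding sets_restrict_space space_arc_length[symmetric]
    using sets.sets_into_space[of _ arc_length] by (auto simp: image_iff)
  show "emeasure (restrict_space arc_length (sphere 0 1)) A = emeasure arc_length A"
    if "A \<in> sets (restrict_space arc_length (sphere 0 1))" for A
    using that sets.sets_into_space[of A arc_length] unfolding s
    by (intro emeasure_restrict_space) (auto simp flip: space_arc_length)
qed

definition herglotz :: "complex \<Rightarrow> complex \<Rightarrow> complex" where
  "herglotz \<zeta> z = (\<zeta> + z) / (\<zeta> - z)"

lemma norm_sphere_diff:
  assumes "\<zeta> \<in> sphere 0 1"
  shows "1 - norm z \<le> norm (\<zeta> - z)"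
  using norm_triangle_ineq2[of \<zeta> z] assms by simp

lemma bounded_kernel_integrable:
  fixes u :: "complex \<Rightarrow> real" and g :: "complex \<Rightarrow> complex"
  assumes "integrable arc_length u" "g \<in> borel_measurable borel"
    and "\<And>\<zeta>. \<zeta> \<in> sphere 0 1 \<Longrightarrow> norm (g \<zeta>) \<le> B"
  shows "integrable arc_length (\<lambda>\<zeta>. g \<zeta> * of_real (u \<zeta>))"
proof (rule Bochner_Integration.integrable_bound)
  show "integrable arc_length (\<lambda>\<zeta>. B * u \<zeta>)" using assms(1) by simp
  have [measurable]: "g \<in> borel_measurable arc_length" "u \<in> borel_measurable arc_length"
    using assms(1,2) by (auto intro: borel_measurable_arc_length)
  show "(\<lambda>\<zeta>. g \<zeta> * of_real (u \<zeta>)) \<in> borel_measurable arc_length" by measurable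
  have "norm (g \<zeta> * of_real (u \<zeta>)) \<le> norm (B * u \<zeta>)" if "\<zeta> \<in> sphere 0 1" for \<zeta>
    using mult_right_mono[OF assms(3)[OF that], of "\<bar>u \<zeta>\<bar>"] assms(3)[OF that]
    by (smt (verit, ccfv_SIG) abs_mult norm_ge_zero norm_mult norm_of_real real_norm_def)
  then show "AE \<zeta> in arc_length. norm (g \<zeta> * of_real (u \<zeta>)) \<le> norm (B * u \<zeta>)"
    by (intro AE_I2) (simp add: space_arc_length)
qed

lemma herglotz_integrable:
  assumes "integrable arc_length u" "z \<in> ball 0 1"
  shows "integrable arc_length (\<lambda>\<zeta>. herglotz \<zeta> z * of_real (u \<zeta>))"
proof (rule bounded_kernel_integrable[OF assms(1)])
  show "(\<lambda>\<zeta>. herglotz \<zeta> z) \<in> borel_measurable borel"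
    unfolding herglotz_def by measurable
  fix \<zeta> :: complex assume z: "\<zeta> \<in> sphere 0 1"
  have "norm (\<zeta> + z) \<le> 2" using norm_triangle_ineq[of \<zeta> z] z assms(2) by simp
  then show "norm (herglotz \<zeta> z) \<le> 2 / (1 - norm z)"
    unfolding herglotz_def norm_divide using norm_sphere_diff[OF z, of z] assms(2)
    by (intro frac_le) auto
qed

text \<open>
  A remainder of second order, uniform in the direction of approach, suffices for complex
  differentiability.
\<close>

lemma has_field_derivative_quadratic:
  fixes G :: "complex \<Rightarrow> complex"
  assumes "e > 0" and "\<And>w. dist w z < e \<Longrightarrow> norm (G w - G z - (w - z) * D) \<le> K * (norm (w - z))\<^sup>2"
  shows "(G has_field_derivative D) (at z)"
  unfolding has_field_derivative_iff
proof (rule LIM_zero_cancel, rule tendsto_norm_zero_cancel,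
    rule tendsto_sandwich[where f = "\<lambda>_. 0" and h = "\<lambda>w. K * norm (w - z)"])
  show "\<forall>\<^sub>F w in at z. norm ((G w - G z) / (w - z) - D) \<le> K * norm (w - z)"
    unfolding eventually_at
  proof (intro exI[of _ e] conjI ballI impI assms(1))
    fix w assume w: "w \<noteq> z \<and> dist w z < e"
    have "norm ((G w - G z) / (w - z) - D) = norm (G w - G z - (w - z) * D) / norm (w - z)"
      using w by (simp add: field_simps flip: norm_divide)
    also have "\<dots> \<le> K * (norm (w - z))\<^sup>2 / norm (w - z)"
      using w assms(2) by (intro divide_right_mono) auto
    finally show "norm ((G w - G z) / (w - z) - D) \<le> K * norm (w - z)"
      using w by (simp add: power2_eq_square)
  qed
  show "((\<lambda>w. K * norm (w - z)) \<longlongrightarrow> 0) (at z)"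
    by (auto intro!: tendsto_eq_intros)
qed auto

text \<open>
  The Taylor remainder of the Herglotz kernel is
  \<open>2 \<zeta> (w - z)\<^sup>2 / ((\<zeta> - z)\<^sup>2 (\<zeta> - w))\<close>, which is bounded by a multiple of \<open>|w - z|\<^sup>2\<close> uniformly
  in \<open>\<zeta>\<close> on the circle, because \<open>\<zeta>\<close> keeps a positive distance from \<open>z\<close> and \<open>w\<close>.
\<close>

lemma herglotz_integral_holomorphic:
  assumes u: "integrable arc_length u"
  shows "(\<lambda>z. LINT \<zeta>|arc_length. herglotz \<zeta> z * of_real (u \<zeta>)) holomorphic_on ball 0 1"
proof (rule holomorphic_onI)
  fix z :: complex assume z: "z \<in> ball 0 1"
  define d where "d = 1 - norm z"
  have d: "d > 0" using z by (simp add: d_def)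
  let ?G = "\<lambda>z. LINT \<zeta>|arc_length. herglotz \<zeta> z * of_real (u \<zeta>)"
  let ?h = "\<lambda>\<zeta>. 2 * \<zeta> / (\<zeta> - z)\<^sup>2"
  have dz: "norm (\<zeta> - z) \<ge> d" if "\<zeta> \<in> sphere 0 1" for \<zeta>
    using norm_sphere_diff[OF that] d_def by simp
  have ih: "integrable arc_length (\<lambda>\<zeta>. ?h \<zeta> * of_real (u \<zeta>))"
  proof (rule bounded_kernel_integrable[OF u])
    fix \<zeta> :: complex assume s: "\<zeta> \<in> sphere 0 1"
    show "norm (?h \<zeta>) \<le> 2 / d\<^sup>2"
      using s d dz[OF s] by (auto simp: norm_divide norm_mult norm_power intro!: frac_le power_mono)
  qed measurable
  have "(?G has_field_derivative (LINT \<zeta>|arc_length. ?h \<zeta> * of_real (u \<zeta>))) (at z)"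
  proof (rule has_field_derivative_quadratic[of "d / 2"])
    fix w assume w: "dist w z < d / 2"
    have wb: "norm w \<le> 1 - d / 2" using w norm_triangle_sub[of w z] by (simp add: dist_norm d_def field_simps)
    then have wball: "w \<in> ball 0 1" using d by simp
    have "?G w - ?G z - (w - z) * (LINT \<zeta>|arc_length. ?h \<zeta> * of_real (u \<zeta>))
       = (LINT \<zeta>|arc_length. herglotz \<zeta> w * of_real (u \<zeta>) - herglotz \<zeta> z * of_real (u \<zeta>)
            - (w - z) * (?h \<zeta> * of_real (u \<zeta>)))"
      using herglotz_integrable[OF u z] herglotz_integrable[OF u wball] ih
      by (simp only: Bochner_Integration.integral_diff Bochner_Integration.integrable_diff
          integral_mult_right_zero integrable_mult_right)
    also have "norm \<dots> \<le> (LINT \<zeta>|arc_length. 4 / d ^ 3 * (norm (w - z))\<^sup>2 * \<bar>u \<zeta>\<bar>)"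
    proof (rule Bochner_Integration.integral_norm_bound_integral)
      show "integrable arc_length (\<lambda>\<zeta>. 4 / d ^ 3 * (norm (w - z))\<^sup>2 * \<bar>u \<zeta>\<bar>)"
        using u by simp
      show "integrable arc_length (\<lambda>\<zeta>. herglotz \<zeta> w * of_real (u \<zeta>) - herglotz \<zeta> z * of_real (u \<zeta>)
            - (w - z) * (?h \<zeta> * of_real (u \<zeta>)))"
        using herglotz_integrable[OF u z] herglotz_integrable[OF u wball] ih
        by (simp only: Bochner_Integration.integrable_diff integrable_mult_right)
      fix \<zeta> assume "\<zeta> \<in> space arc_length"
      then have s: "\<zeta> \<in> sphere 0 1" by (simp add: space_arc_length)
      have dw: "norm (\<zeta> - w) \<ge> d / 2" using norm_sphere_diff[OF s, of w] wb by simp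
      have nz: "\<zeta> - z \<noteq> 0" "\<zeta> - w \<noteq> 0" using dw dz[OF s] d by auto
      have "herglotz \<zeta> w * of_real (u \<zeta>) - herglotz \<zeta> z * of_real (u \<zeta>) - (w - z) * (?h \<zeta> * of_real (u \<zeta>))
         = (herglotz \<zeta> w - herglotz \<zeta> z - (w - z) * ?h \<zeta>) * of_real (u \<zeta>)"
        by (simp add: algebra_simps)
      also have "herglotz \<zeta> w - herglotz \<zeta> z - (w - z) * ?h \<zeta> = 2 * \<zeta> * (w - z)\<^sup>2 / ((\<zeta> - z)\<^sup>2 * (\<zeta> - w))"
        unfolding herglotz_def using nz
        by (simp add: divide_simps) (simp add: algebra_simps power2_eq_square)
      also have "norm (\<dots> * complex_of_real (u \<zeta>)) = 2 * (norm (w - z))\<^sup>2 / ((norm (\<zeta> - z))\<^sup>2 * norm (\<zeta> - w)) * \<bar>u \<zeta>\<bar>"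
        using s by (simp add: norm_mult norm_divide norm_power)
      also have "\<dots> \<le> 2 * (norm (w - z))\<^sup>2 / (d\<^sup>2 * (d / 2)) * \<bar>u \<zeta>\<bar>"
        using d dz[OF s] dw by (intro mult_right_mono frac_le mult_mono power_mono) auto
      also have "\<dots> = 4 / d ^ 3 * (norm (w - z))\<^sup>2 * \<bar>u \<zeta>\<bar>"
        by (simp add: power2_eq_square power3_eq_cube)
      finally show "norm (herglotz \<zeta> w * of_real (u \<zeta>) - herglotz \<zeta> z * of_real (u \<zeta>)
            - (w - z) * (?h \<zeta> * of_real (u \<zeta>))) \<le> 4 / d ^ 3 * (norm (w - z))\<^sup>2 * \<bar>u \<zeta>\<bar>" .
    qed
    also have "\<dots> = (4 / d ^ 3 * (LINT \<zeta>|arc_length. \<bar>u \<zeta>\<bar>)) * (norm (w - z))\<^sup>2" by simp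
    finally show "norm (?G w - ?G z - (w - z) * (LINT \<zeta>|arc_length. ?h \<zeta> * of_real (u \<zeta>)))
       \<le> (4 / d ^ 3 * (LINT \<zeta>|arc_length. \<bar>u \<zeta>\<bar>)) * (norm (w - z))\<^sup>2" .
  qed (use d in simp)
  then show "?G field_differentiable at z within ball 0 1"
    using field_differentiable_def field_differentiable_at_within by blast
qed

lemma outer_fun_arc_length:
  "outer_fun f z = exp ((LINT \<zeta>|arc_length. herglotz \<zeta> z * of_real (ln (f \<zeta>))) / of_real (2 * pi))"
proof -
  let ?k = "\<lambda>\<zeta>. herglotz \<zeta> z * of_real (ln (f \<zeta>)) / of_real (2 * pi)"
  have "outer_fun f z = exp (LINT \<theta>:{- pi..pi}|lebesgue. ?k (cis \<theta>))"
    unfolding outer_fun_def herglotz_def ..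
  also have "\<dots> = exp (integral\<^sup>L arc_length ?k)"
    by (subst arc_length_integrable(2)) (rule refl)
  also have "integral\<^sup>L arc_length ?k
      = (LINT \<zeta>|arc_length. herglotz \<zeta> z * of_real (ln (f \<zeta>))) / of_real (2 * pi)"
    by (rule integral_divide_zero)
  finally show ?thesis .
qed

lemma outer_fun_holomorphic:
  assumes "integrable arc_length (\<lambda>\<zeta>. ln (f \<zeta>))"
  shows "outer_fun f holomorphic_on ball 0 1"
  unfolding outer_fun_arc_length
  by (intro holomorphic_intros herglotz_integral_holomorphic assms) auto

text \<open>
  The Poisson kernel of the upper half-plane without the factor \<open>1 / pi\<close>: its integral is \<open>pi\<close>.
\<close>

definition poisson :: "complex \<Rightarrow> real \<Rightarrow> real" where
  "poisson v x = Im v / ((x - Re v)\<^sup>2 + (Im v)\<^sup>2)"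

lemma poisson_pos: "Im v > 0 \<Longrightarrow> poisson v x > 0"
  unfolding poisson_def by (simp add: add_nonneg_pos)

text \<open>
  In half-plane coordinates the Herglotz kernel is \<open>\<i> (1 + x v) / (v - x)\<close>.
\<close>

lemma Re_herglotz_line_pt:
  assumes "Im v > 0"
  shows "line_wt x * Re (herglotz (line_pt x) (of_halfplane v)) = 2 * poisson v x"
proof -
  have x: "complex_of_real x + \<i> \<noteq> 0" by (simp add: complex_eq_iff)
  have v: "v + \<i> \<noteq> 0" "v - of_real x \<noteq> 0" using assms by (auto simp: complex_eq_iff)
  have "line_pt x + of_halfplane v = 2 * (1 + of_real x * v) / ((of_real x + \<i>) * (v + \<i>))"
    unfolding line_pt_def of_halfplane_def using x v by (simp add: divide_simps) (simp add: algebra_simps)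
  moreover have "line_pt x - of_halfplane v = - 2 * \<i> * (v - of_real x) / ((of_real x + \<i>) * (v + \<i>))"
    unfolding line_pt_def of_halfplane_def using x v by (simp add: divide_simps) (simp add: algebra_simps)
  ultimately have "herglotz (line_pt x) (of_halfplane v) = \<i> * (1 + of_real x * v) / (v - of_real x)"
    unfolding herglotz_def using x v by (simp only:) (simp add: divide_simps)
  also have "Re \<dots> = Im v * (1 + x\<^sup>2) / ((x - Re v)\<^sup>2 + (Im v)\<^sup>2)"
    by (simp add: Re_divide power2_eq_square algebra_simps)
  finally show ?thesis
    by (simp add: line_wt_def poisson_def add_nonneg_eq_0_iff)
qed

text \<open>
  Up to the affine substitution \<open>x \<mapsto> Re v + Im v * x\<close> and a factor, the kernel is \<open>line_wt\<close>,
  whose integral is the length of the circle.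
\<close>

lemma poisson_integral:
  assumes "Im v > 0"
  shows "integrable lebesgue (poisson v)" and "(LINT x|lebesgue. poisson v x) = pi"
proof -
  have *: "line_wt x = 2 * Im v * poisson v (Re v + Im v * x)" for x
  proof -
    have "(Im v * x)\<^sup>2 + (Im v)\<^sup>2 = (Im v)\<^sup>2 * (1 + x\<^sup>2)" by (simp add: algebra_simps)
    then show ?thesis using assms by (simp add: line_wt_def poisson_def power2_eq_square)
  qed
  have "integrable lebesgue (\<lambda>x. 2 * Im v * poisson v (Re v + Im v * x))"
    using line_wt_integrable unfolding * [abs_def] .
  then show "integrable lebesgue (poisson v)"
    using assms by (simp add: lebesgue_integrable_real_affine_iff)
  have "(LINT x|lebesgue. poisson v x) = Im v * (LINT x|lebesgue. poisson v (Re v + Im v * x))"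
    using assms lebesgue_integral_real_affine[of "Im v" "poisson v" "Re v"] by simp
  also have "\<dots> = (LINT x|lebesgue. line_wt x) / 2" unfolding * by simp
  finally show "(LINT x|lebesgue. poisson v x) = pi" by (simp add: line_wt_integral)
qed

lemma to_halfplane_ball:
  assumes "z \<in> ball 0 1"
  shows "Im (to_halfplane z) > 0" and "of_halfplane (to_halfplane z) = z"
proof -
  have "z \<noteq> 1" "(norm z)\<^sup>2 < 1" using assms by (auto simp: abs_square_less_1)
  then show "Im (to_halfplane z) > 0" "of_halfplane (to_halfplane z) = z"
    by (auto simp: Im_to_halfplane of_to_halfplane)
qed

lemma norm_outer_fun:
  assumes u: "integrable arc_length (\<lambda>\<zeta>. ln (f \<zeta>))" and v: "Im v > 0" and z: "of_halfplane v \<in> ball 0 1"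
  shows "integrable lebesgue (\<lambda>x. poisson v x * ln (f (line_pt x)))"
    and "norm (outer_fun f (of_halfplane v)) = exp ((LINT x|lebesgue. poisson v x * ln (f (line_pt x))) / pi)"
proof -
  let ?k = "\<lambda>\<zeta>. Re (herglotz \<zeta> (of_halfplane v)) * ln (f \<zeta>)"
  have i: "integrable arc_length (\<lambda>\<zeta>. herglotz \<zeta> (of_halfplane v) * of_real (ln (f \<zeta>)))"
    by (rule herglotz_integrable[OF u z])
  have k: "integrable arc_length ?k" using integrable_Re[OF i] by simp
  have e: "line_wt x * ?k (line_pt x) = 2 * (poisson v x * ln (f (line_pt x)))" for x
    using Re_herglotz_line_pt[OF v, of x] by (simp add: mult.assoc[symmetric])
  show "integrable lebesgue (\<lambda>x. poisson v x * ln (f (line_pt x)))"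
    using k unfolding arc_length_line(1) e by simp
  have "Re (LINT \<zeta>|arc_length. herglotz \<zeta> (of_halfplane v) * of_real (ln (f \<zeta>))) = integral\<^sup>L arc_length ?k"
    by (subst integral_Re[OF i, symmetric]) simp
  also have "\<dots> = 2 * (LINT x|lebesgue. poisson v x * ln (f (line_pt x)))"
    unfolding arc_length_line(2) e by simp
  finally show "norm (outer_fun f (of_halfplane v)) = exp ((LINT x|lebesgue. poisson v x * ln (f (line_pt x))) / pi)"
    unfolding outer_fun_arc_length norm_exp_eq_Re by simp
qed

text \<open>
  \<open>ln |outer_fun f|\<close> is an average of \<open>ln f\<close> against the Poisson kernel. The maximum with \<open>1\<close> keeps the
  logarithm of the bound meaningful when \<open>C\<close> is not positive.
\<close>

lemma outer_fun_bounded: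
  assumes u: "integrable arc_length (\<lambda>\<zeta>. ln (f \<zeta>))"
    and f: "AE \<zeta> in arc_length. 0 < f \<zeta>" "AE \<zeta> in arc_length. f \<zeta> \<le> C"
    and z: "z \<in> ball 0 1"
  shows "norm (outer_fun f z) \<le> max 1 C"
proof -
  define v where "v = to_halfplane z"
  have v: "Im v > 0" "of_halfplane v = z" using to_halfplane_ball[OF z] by (simp_all add: v_def)
  have n: "integrable lebesgue (\<lambda>x. poisson v x * ln (f (line_pt x)))"
    "norm (outer_fun f z) = exp ((LINT x|lebesgue. poisson v x * ln (f (line_pt x))) / pi)"
    using norm_outer_fun[OF u v(1)] z v(2) by auto
  have "(LINT x|lebesgue. poisson v x * ln (f (line_pt x))) \<le> (LINT x|lebesgue. poisson v x * ln (max 1 C))"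
  proof (rule integral_mono_AE[OF n(1)])
    show "integrable lebesgue (\<lambda>x. poisson v x * ln (max 1 C))"
      using poisson_integral[OF v(1)] by simp
    have "AE x in lebesgue. 0 < f (line_pt x)" "AE x in lebesgue. f (line_pt x) \<le> C"
      using f unfolding arc_length_AE by auto
    then show "AE x in lebesgue. poisson v x * ln (f (line_pt x)) \<le> poisson v x * ln (max 1 C)"
      by eventually_elim (use poisson_pos[OF v(1)] in \<open>auto intro!: mult_left_mono simp: less_imp_le\<close>)
  qed
  also have "\<dots> = pi * ln (max 1 C)" using poisson_integral[OF v(1)] by simp
  finally have "norm (outer_fun f z) \<le> exp (ln (max 1 C))"
    unfolding n by (subst exp_le_cancel_iff) (simp add: divide_le_eq mult.commute)
  then show ?thesis by simp
qed

lemma weight_on_sphere: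
  "weight_on (sphere 0 1) f \<longleftrightarrow>
     (\<forall>\<zeta>\<in>sphere 0 1. f \<zeta> \<ge> 0) \<and> f \<in> borel_measurable arc_length \<and>
     (\<exists>C. AE \<zeta> in arc_length. f \<zeta> \<le> C) \<and>
     (AE \<zeta> in arc_length. f \<zeta> > 0) \<and> integrable arc_length (\<lambda>\<zeta>. ln (f \<zeta>))"
proof -
  have "(AE \<zeta> in arc_length. \<bar>f \<zeta>\<bar> \<le> C) \<longleftrightarrow> (AE \<zeta> in arc_length. f \<zeta> \<le> C)" if "\<forall>\<zeta>\<in>sphere 0 1. f \<zeta> \<ge> 0" for C
    by (rule AE_cong) (use that in \<open>auto simp: space_arc_length\<close>)
  then show ?thesis
    unfolding weight_on_def ess_bounded_def log_integrable_def restrict_space_arc_length by blast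
qed

lemma is_outer_outer_fun:
  assumes "weight_on (sphere 0 1) f"
  shows "is_outer f (outer_fun f)"
proof -
  obtain C where u: "integrable arc_length (\<lambda>\<zeta>. ln (f \<zeta>))"
    and f: "AE \<zeta> in arc_length. 0 < f \<zeta>" "AE \<zeta> in arc_length. f \<zeta> \<le> C"
    using assms unfolding weight_on_sphere by blast
  have "bounded (outer_fun f ` ball 0 1)"
    using outer_fun_bounded[OF u f] by (intro boundedI[of _ "max 1 C"]) auto
  then show ?thesis
    using assms outer_fun_holomorphic[OF u] unfolding is_outer_def H_inf_def by blast
qed

section \<open>Uniqueness for Poisson integrals on the line\<close>

lemma borel_eq_open_intervals:
  "borel = sigma UNIV (range (\<lambda>(a, b). {a <..< b}) :: real set set)"
proof -
  have "range (\<lambda>(a, b). box a b) = (range (\<lambda>(a, b). {a <..< b}) :: real set set)"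
    by (simp add: box_real)
  then show ?thesis using borel_eq_box[where 'a = real] by simp
qed

text \<open>
  Open intervals form an intersection-stable generator of the Borel sets, so by Dynkin's argument the
  integral over every Borel set vanishes.
\<close>

lemma AE_zero_if_interval_integrals_zero:
  fixes h :: "real \<Rightarrow> real"
  assumes h: "integrable lborel h" and total: "integral\<^sup>L lborel h = 0"
    and iv: "\<And>c d. c < d \<Longrightarrow> (LINT x:{c<..<d}|lborel. h x) = 0"
  shows "AE x in lborel. h x = 0"
proof (rule sigma_finite_measure.density_zero[OF sigma_finite_lborel h])
  let ?G = "range (\<lambda>(a, b). {a <..< b}) :: real set set"
  have sh: "set_integrable lborel A h" if "A \<in> sets borel" for A
    unfolding set_integrable_def using h that by (intro integrable_mult_indicator) auto
  fix A assume "A \<in> sets (lborel :: real measure)"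
  then have mem: "A \<in> sigma_sets UNIV ?G"
    by (simp add: borel_eq_open_intervals)
  have stable: "Int_stable ?G"
  proof (rule Int_stableI)
    fix X Y assume "X \<in> ?G" "Y \<in> ?G"
    then obtain a b c d where "X = {a<..<b}" "Y = {c<..<d}" by auto
    then have "X \<inter> Y = (\<lambda>(a, b). {a <..< b}) (max a c, min b d)" by auto
    then show "X \<inter> Y \<in> ?G" by blast
  qed
  have pow: "?G \<subseteq> Pow UNIV" by simp
  show "(LINT x:A|lborel. h x) = 0"
    using stable pow mem
  proof (induction rule: sigma_sets_induct_disjoint)
    case (basic A)
    then obtain a b where "A = {a<..<b}" by auto
    then show ?case using iv[of a b] by (cases "a < b") (auto simp: set_lebesgue_integral_def)
  next
    case empty
    show ?case by (simp add: set_lebesgue_integral_def)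
  next
    case (compl A)
    then have m: "A \<in> sets borel" by (simp add: borel_eq_open_intervals)
    have "(LINT x:(UNIV - A)|lborel. h x) = (LINT x|lborel. h x - indicator A x *\<^sub>R h x)"
      unfolding set_lebesgue_integral_def by (intro Bochner_Integration.integral_cong) (auto simp: indicator_def)
    also have "\<dots> = 0"
      using compl.IH sh[OF m] h total unfolding set_lebesgue_integral_def set_integrable_def
      by (subst Bochner_Integration.integral_diff) auto
    finally show ?case .
  next
    case (union A)
    then have m: "range A \<subseteq> sets borel" by (simp add: borel_eq_open_intervals)
    have "(LINT x:(\<Union>i. A i)|lborel. h x) = (\<Sum>i. (LINT x:(A i)|lborel. h x))"
      by (rule lebesgue_integral_countable_add)
        (use m union.hyps(1) sh in \<open>auto simp: disjoint_family_on_def\<close>)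
    then show ?case using union.IH by simp
  qed
qed

lemma power2_le_if_abs_le: "\<bar>x\<bar> \<le> y \<Longrightarrow> x\<^sup>2 \<le> y\<^sup>2" for x y :: real
  using power_mono[of "\<bar>x\<bar>" y 2] by simp

lemma poisson_bound:
  assumes "y > 0" "\<bar>r\<bar> \<le> R"
  shows "poisson (Complex r y) s \<le> y * (2 + (1 + 2 * R\<^sup>2) / y\<^sup>2) / 2 * line_wt s"
proof -
  let ?D = "(s - r)\<^sup>2 + y\<^sup>2"
  have D: "?D > 0" using assms by (simp add: add_nonneg_pos)
  have "s\<^sup>2 \<le> 2 * (s - r)\<^sup>2 + 2 * r\<^sup>2"
    using zero_le_power2[of "s - 2 * r"] by (simp add: power2_eq_square algebra_simps)
  moreover have "r\<^sup>2 \<le> R\<^sup>2" using assms(2) by (rule power2_le_if_abs_le)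
  moreover have "1 + 2 * R\<^sup>2 \<le> (1 + 2 * R\<^sup>2) / y\<^sup>2 * ?D"
    using assms by (simp add: field_simps)
  ultimately have "1 + s\<^sup>2 \<le> (2 + (1 + 2 * R\<^sup>2) / y\<^sup>2) * ?D"
    unfolding distrib_right[of 2] using zero_le_power2[of y] by argo
  then have "y * (1 + s\<^sup>2) \<le> y * ((2 + (1 + 2 * R\<^sup>2) / y\<^sup>2) * ?D)"
    using assms(1) by (intro mult_left_mono) auto
  moreover have "1 + s\<^sup>2 > 0" by (simp add: add_pos_nonneg)
  ultimately have "y / ?D \<le> y * (2 + (1 + 2 * R\<^sup>2) / y\<^sup>2) / (1 + s\<^sup>2)"
    using D by (simp add: pos_divide_le_eq pos_le_divide_eq mult.assoc)
  then show ?thesis by (simp add: poisson_def line_wt_def)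
qed

text \<open>
  The Poisson integral of the indicator of \<open>[c, d]\<close> at \<open>s + \<i> y\<close>, up to the factor \<open>1 / pi\<close>, in closed
  form; compare \<open>poisson_integral_interval\<close>.
\<close>

definition interval_mass :: "real \<Rightarrow> real \<Rightarrow> real \<Rightarrow> real \<Rightarrow> real" where
  "interval_mass c d y s = arctan ((d - s) / y) - arctan ((c - s) / y)"

lemma poisson_integral_interval:
  assumes "y > 0" "c \<le> d"
  shows "(LINT x|lborel. indicator {c..d} x * poisson (Complex x y) s) = interval_mass c d y s"
proof -
  have "(LINT x|lborel. poisson (Complex x y) s * indicator {c..d} x) = arctan ((d - s) / y) - arctan ((c - s) / y)"
  proof (rule integral_FTC_Icc_real[OF assms(2)])
    fix x
    have nz: "(s - x)\<^sup>2 + y\<^sup>2 \<noteq> 0" using assms(1) by (simp add: add_nonneg_eq_0_iff)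
    have "inverse (1 + ((x - s) / y)\<^sup>2) * (1 / y) = poisson (Complex x y) s"
      using assms(1) nz
      by (simp add: poisson_def power_divide divide_simps power2_commute[of x s]) 
         (simp add: power2_eq_square algebra_simps)
    moreover have "((\<lambda>x. arctan ((x - s) / y)) has_real_derivative inverse (1 + ((x - s) / y)\<^sup>2) * (1 / y)) (at x)"
      using assms(1) by (auto intro!: derivative_eq_intros)
    ultimately show "((\<lambda>x. arctan ((x - s) / y)) has_real_derivative poisson (Complex x y) s) (at x)" by simp
    show "isCont (\<lambda>x. poisson (Complex x y) s) x"
      unfolding poisson_def using nz by (auto intro!: continuous_intros)
  qed
  then show ?thesis by (simp add: mult.commute interval_mass_def)
qed

text \<open>
  A bound uniform in \<open>y \<le> 1\<close>, needed for dominated convergence against functions that are integrable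
  only with the weight \<open>line_wt\<close>. Near \<open>[c, d]\<close> the mass is at most \<open>pi\<close>; far away, the mean value
  theorem bounds it by the length of the interval times the kernel, which decays like \<open>1 / s\<^sup>2\<close>.
\<close>

lemma interval_mass_bound:
  assumes "0 < y" "y \<le> 1" "c < d" "\<bar>c\<bar> \<le> R" "\<bar>d\<bar> \<le> R"
  shows "\<bar>interval_mass c d y s\<bar> \<le> (pi * (1 + (2 * R + 1)\<^sup>2) + 8 * (d - c)) * line_wt s"
proof -
  have "(c - s) / y \<le> (d - s) / y" using assms by (simp add: divide_right_mono)
  then have nn: "interval_mass c d y s \<ge> 0" unfolding interval_mass_def by (simp add: arctan_le_iff)
  have p: "1 + s\<^sup>2 > 0" by (simp add: add_pos_nonneg)
  then have w: "line_wt s * (1 + s\<^sup>2) = 2" by (simp add: line_wt_def field_simps)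
  show ?thesis
  proof (cases "\<bar>s\<bar> \<le> 2 * R + 1")
    case True
    have "interval_mass c d y s \<le> pi"
      unfolding interval_mass_def using arctan_ubound[of "(d - s) / y"] arctan_lbound[of "(c - s) / y"] by linarith
    also have "pi * (1 + s\<^sup>2) \<le> pi * (1 + (2 * R + 1)\<^sup>2) * (line_wt s * (1 + s\<^sup>2))"
      unfolding w using power2_le_if_abs_le[OF True] 
      by (intro order_trans[OF mult_left_mono[of "1 + s\<^sup>2" "1 + (2 * R + 1)\<^sup>2"]]) (auto simp: algebra_simps)
    then have "pi \<le> pi * (1 + (2 * R + 1)\<^sup>2) * line_wt s"
      using p by (simp only: mult.assoc[symmetric] mult_le_cancel_right_pos)
    also have "\<dots> \<le> (pi * (1 + (2 * R + 1)\<^sup>2) + 8 * (d - c)) * line_wt s"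
      using assms line_wt_pos[of s] by (intro mult_right_mono) auto
    finally show ?thesis using nn by simp
  next
    case False
    have D: "((\<lambda>x. arctan ((x - s) / y)) has_real_derivative inverse (1 + ((x - s) / y)\<^sup>2) * (1 / y)) (at x)" for x
      using assms(1) by (auto intro!: derivative_eq_intros)
    obtain x where x: "c < x" "x < d" "arctan ((d - s) / y) - arctan ((c - s) / y)
        = (d - c) * (inverse (1 + ((x - s) / y)\<^sup>2) * (1 / y))"
      using MVT2[OF assms(3) D] by blast
    have xs: "\<bar>x - s\<bar> \<ge> \<bar>s\<bar> / 2" "\<bar>s\<bar> \<ge> 1" using x(1,2) assms(4,5) False by linarith+
    have "(x - s)\<^sup>2 \<ge> (\<bar>s\<bar> / 2)\<^sup>2" using xs(1) by (intro abs_le_square_iff[THEN iffD1]) auto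
    then have x2: "(x - s)\<^sup>2 \<ge> s\<^sup>2 / 4" by (simp add: power_divide)
    have s2: "s\<^sup>2 \<ge> 1" using abs_le_square_iff[of 1 s] xs(2) by simp
    have "inverse (1 + ((x - s) / y)\<^sup>2) * (1 / y) = y / (y\<^sup>2 + (x - s)\<^sup>2)"
      using assms(1) by (simp add: power_divide divide_simps add_nonneg_eq_0_iff) (simp add: power2_eq_square)
    also have "\<dots> \<le> 1 / (s\<^sup>2 / 4)"
    proof (rule frac_le)
      show "s\<^sup>2 / 4 \<le> y\<^sup>2 + (x - s)\<^sup>2" using x2 zero_le_power2[of y] by argo
    qed (use assms(1,2) s2 in auto)
    also have "\<dots> \<le> 8 / (1 + s\<^sup>2)" using s2 by (simp add: divide_simps)
    also have "\<dots> \<le> 8 * line_wt s" unfolding line_wt_def using p by (simp add: divide_simps)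
    finally have "interval_mass c d y s \<le> (d - c) * (8 * line_wt s)"
      unfolding interval_mass_def x(3) using assms(3) by (intro mult_left_mono) auto
    also have "\<dots> \<le> (pi * (1 + (2 * R + 1)\<^sup>2) + 8 * (d - c)) * line_wt s"
      using line_wt_pos[of s] by (simp add: algebra_simps)
    finally show ?thesis using nn by simp
  qed
qed

lemma interval_mass_limit:
  assumes "c < d" "s \<noteq> c" "s \<noteq> d"
  shows "(\<lambda>n. interval_mass c d (1 / real (Suc n)) s) \<longlonglongrightarrow> pi * indicator {c<..<d} s"
proof -
  have S: "filterlim (\<lambda>n. real (Suc n)) at_top sequentially"
    by (rule filterlim_compose[OF filterlim_real_sequentially filterlim_Suc])
  have e: "(\<lambda>n. arctan (b / (1 / real (Suc n)))) \<longlonglongrightarrow> (pi / 2) * sgn b" if "b \<noteq> 0" for b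
  proof (cases "b > 0")
    case True
    have "filterlim (\<lambda>n. b * real (Suc n)) at_top sequentially"
      using True by (intro filterlim_tendsto_pos_mult_at_top[OF tendsto_const])
         (rule S | simp)+
    from filterlim_compose[OF tendsto_arctan_at_top this] show ?thesis using True by simp
  next
    case False
    have "filterlim (\<lambda>n. b * real (Suc n)) at_bot sequentially"
      using False that by (intro filterlim_tendsto_neg_mult_at_bot[OF tendsto_const])
         (rule S | simp)+
    from filterlim_compose[OF tendsto_arctan_at_bot this] show ?thesis using False that by simp
  qed
  have "(\<lambda>n. interval_mass c d (1 / real (Suc n)) s) \<longlonglongrightarrow> (pi / 2) * sgn (d - s) - (pi / 2) * sgn (c - s)"
    unfolding interval_mass_def using assms by (intro tendsto_diff e) auto
  also have "(pi / 2) * sgn (d - s) - (pi / 2) * sgn (c - s) = pi * indicator {c<..<d} s"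
    using assms by (auto simp: indicator_def sgn_if)
  finally show ?thesis .
qed

lemma poisson_borel [measurable]: "poisson v \<in> borel_measurable borel"
  unfolding poisson_def by measurable

lemma line_wt_borel [measurable]: "line_wt \<in> borel_measurable borel"
  unfolding line_wt_def by measurable

text \<open>
  The Poisson kernel is symmetric in the real parts of its two arguments. Integrating the vanishing
  Poisson integrals along the segment from \<open>c + \<i> y\<close> to \<open>d + \<i> y\<close> and exchanging the integrals
  therefore moves the kernel from \<open>g\<close> to the indicator of \<open>[c, d]\<close>.
\<close>

lemma integral_interval_mass_eq_0:
  fixes g :: "real \<Rightarrow> real"
  assumes [measurable]: "g \<in> borel_measurable borel"
    and gi: "integrable lborel (\<lambda>s. line_wt s * g s)"
    and zero: "\<And>v. Im v > 0 \<Longrightarrow> (LINT s|lborel. poisson v s * g s) = 0"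
    and y: "y > 0" and cd: "c < d"
  shows "(LINT s|lborel. interval_mass c d y s * g s) = 0"
proof -
  define R where "R = max \<bar>c\<bar> \<bar>d\<bar>"
  define M where "M = y * (2 + (1 + 2 * R\<^sup>2) / y\<^sup>2) / 2"
  let ?K = "\<lambda>x s. indicator {c..d} x * (poisson (Complex x y) s * g s)"
  have [measurable]: "g \<in> borel_measurable lborel" by simp
  have [measurable]: "(\<lambda>(x, s). ?K x s) \<in> borel_measurable (lborel \<Otimes>\<^sub>M lborel)"
    unfolding poisson_def complex.sel by measurable
  have "integrable (lborel \<Otimes>\<^sub>M lborel) (\<lambda>(x, s). indicator {c..d} x * (line_wt s * g s))"
  proof (rule lborel_pair.Fubini_integrable)
    show "AE x in lborel. integrable lborel (\<lambda>s. case (x, s) of (x, s) \<Rightarrow> indicator {c..d} x * (line_wt s * g s))"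
      using gi by simp
    have "(\<lambda>x. LINT s|lborel. norm (case (x, s) of (x, s) \<Rightarrow> indicator {c..d} x * (line_wt s * g s)))
       = (\<lambda>x. indicator {c..d} x * (LINT s|lborel. norm (line_wt s * g s)))"
      by (simp add: abs_mult)
    then show "integrable lborel (\<lambda>x. LINT s|lborel. norm (case (x, s) of (x, s) \<Rightarrow> indicator {c..d} x * (line_wt s * g s)))"
      using cd by (simp add: integrable_indicator_iff emeasure_lborel_Icc)
  qed measurable
  then have iK: "integrable (lborel \<Otimes>\<^sub>M lborel) (\<lambda>(x, s). M * (indicator {c..d} x * (line_wt s * g s)))"
    using integrable_mult_right[of M "lborel \<Otimes>\<^sub>M lborel" "\<lambda>(x, s). indicator {c..d} x * (line_wt s * g s)"]
    by (simp add: case_prod_unfold)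
  have bound: "\<bar>?K x s\<bar> \<le> \<bar>M * (indicator {c..d} x * (line_wt s * g s))\<bar>" for x s
  proof (cases "x \<in> {c..d}")
    case True
    then have "poisson (Complex x y) s \<le> M * line_wt s"
      unfolding M_def by (intro poisson_bound y) (auto simp: R_def)
    moreover have "poisson (Complex x y) s > 0" using y by (intro poisson_pos) simp
    ultimately have "\<bar>poisson (Complex x y) s\<bar> \<le> \<bar>M * line_wt s\<bar>" by linarith
    then have "\<bar>poisson (Complex x y) s\<bar> * \<bar>g s\<bar> \<le> \<bar>M * line_wt s\<bar> * \<bar>g s\<bar>"
      by (rule mult_right_mono) simp
    then show ?thesis using True by (simp add: abs_mult mult.assoc)
  qed simp
  have "integrable (lborel \<Otimes>\<^sub>M lborel) (\<lambda>(x, s). ?K x s)"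
    by (rule Bochner_Integration.integrable_bound[OF iK]) (use bound in \<open>auto\<close>)
  then have "(LINT s|lborel. (LINT x|lborel. ?K x s)) = (LINT x|lborel. (LINT s|lborel. ?K x s))"
    by (rule lborel_pair.Fubini_integral)
  also have "\<dots> = 0" using zero y by simp
  finally have "(LINT s|lborel. (LINT x|lborel. ?K x s)) = 0" .
  moreover have "(LINT x|lborel. ?K x s) = interval_mass c d y s * g s" for s
    using poisson_integral_interval[OF y, of c d s] cd by (simp add: mult.assoc[symmetric])
  ultimately show ?thesis by simp
qed

text \<open>
  As \<open>y\<close> tends to \<open>0\<close>, the mass of the interval tends to \<open>pi\<close> times its indicator.
\<close>

lemma integral_interval_eq_0:
  fixes g :: "real \<Rightarrow> real"
  assumes [measurable]: "g \<in> borel_measurable borel"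
    and gi: "integrable lborel (\<lambda>s. line_wt s * g s)"
    and zero: "\<And>v. Im v > 0 \<Longrightarrow> (LINT s|lborel. poisson v s * g s) = 0"
    and cd: "c < d"
  shows "(LINT s:{c<..<d}|lborel. g s) = 0"
proof -
  define R where "R = max \<bar>c\<bar> \<bar>d\<bar>"
  define M where "M = pi * (1 + (2 * R + 1)\<^sup>2) + 8 * (d - c)"
  let ?s = "\<lambda>n s. interval_mass c d (1 / real (Suc n)) s * g s"
  have "(\<lambda>n. LINT s|lborel. ?s n s) \<longlonglongrightarrow> (LINT s|lborel. pi * indicator {c<..<d} s * g s)"
  proof (rule integral_dominated_convergence[where w = "\<lambda>s. M * \<bar>line_wt s * g s\<bar>"])
    show "integrable lborel (\<lambda>s. M * \<bar>line_wt s * g s\<bar>)" using gi by simp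
    show "AE s in lborel. (\<lambda>n. ?s n s) \<longlonglongrightarrow> pi * indicator {c<..<d} s * g s"
      using AE_lborel_singleton[of c] AE_lborel_singleton[of d]
      by eventually_elim (intro tendsto_mult tendsto_const interval_mass_limit cd, auto)
    fix n
    have "\<bar>interval_mass c d (1 / real (Suc n)) s\<bar> \<le> M * line_wt s" for s
      unfolding M_def R_def by (intro interval_mass_bound cd) auto
    then have "\<bar>interval_mass c d (1 / real (Suc n)) s\<bar> * \<bar>g s\<bar> \<le> M * line_wt s * \<bar>g s\<bar>" for s
      by (intro mult_right_mono) auto
    then show "AE s in lborel. norm (?s n s) \<le> M * \<bar>line_wt s * g s\<bar>"
      using line_wt_pos by (auto simp: abs_mult mult.assoc abs_of_pos)
  qed (unfold interval_mass_def, measurable)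
  moreover have "(LINT s|lborel. ?s n s) = 0" for n
    by (rule integral_interval_mass_eq_0[OF assms(1) gi zero _ cd]) auto
  ultimately have "(LINT s|lborel. pi * indicator {c<..<d} s * g s) = 0"
    using LIMSEQ_unique[OF _ tendsto_const] by simp
  then show ?thesis by (simp add: set_lebesgue_integral_def mult.assoc)
qed

lemma poisson_unique_borel:
  fixes g :: "real \<Rightarrow> real"
  assumes [measurable]: "g \<in> borel_measurable borel"
    and gi: "integrable lborel (\<lambda>s. line_wt s * g s)"
    and zero: "\<And>v. Im v > 0 \<Longrightarrow> (LINT s|lborel. poisson v s * g s) = 0"
  shows "AE s in lborel. g s = 0"
proof -
  have "AE s in lborel. indicator {- real (Suc N) <..< real (Suc N)} s * g s = 0" for N
  proof (rule AE_zero_if_interval_integrals_zero)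
    define B where "B = real (Suc N)"
    have B: "B > 0" by (simp add: B_def)
    let ?I = "{- B <..< B}"
    have "integrable lborel (\<lambda>s. indicator ?I s * g s)"
    proof (rule Bochner_Integration.integrable_bound)
      show "integrable lborel (\<lambda>s. (1 + B\<^sup>2) * (line_wt s * g s))" using gi by simp
      have "1 \<le> (1 + B\<^sup>2) * line_wt s" if "s \<in> ?I" for s
      proof -
        have "s\<^sup>2 \<le> B\<^sup>2" using that by (intro power2_le_if_abs_le) auto
        then have "1 + s\<^sup>2 \<le> (1 + B\<^sup>2) * 2" using zero_le_power2[of B] by argo
        then show ?thesis by (simp add: line_wt_def add_pos_nonneg pos_le_divide_eq)
      qed
      then have "\<bar>indicator ?I s * g s\<bar> \<le> ((1 + B\<^sup>2) * line_wt s) * \<bar>g s\<bar>" for s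
        using mult_right_mono[of 1 "(1 + B\<^sup>2) * line_wt s" "\<bar>g s\<bar>"] line_wt_pos[of s] B
        by (cases "s \<in> ?I") (auto simp: less_imp_le)
      also have "((1 + B\<^sup>2) * line_wt s) * \<bar>g s\<bar> = \<bar>(1 + B\<^sup>2) * (line_wt s * g s)\<bar>" for s
        using line_wt_pos[of s] by (simp add: abs_mult)
      finally show "AE s in lborel. norm (indicator ?I s * g s) \<le> norm ((1 + B\<^sup>2) * (line_wt s * g s))"
        by simp
    qed measurable
    then show "integrable lborel (\<lambda>s. indicator {- real (Suc N) <..< real (Suc N)} s * g s)"
      by (simp add: B_def)
    have 0: "(LINT s:{c<..<d}|lborel. g s) = 0" for c d
      using integral_interval_eq_0[OF assms, of c d] by (cases "c < d") (auto simp: set_lebesgue_integral_def)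
    show "(LINT s|lborel. indicator {- real (Suc N) <..< real (Suc N)} s * g s) = 0"
      using 0[of "- B" B] by (simp add: set_lebesgue_integral_def B_def)
    fix c d :: real
    have "(\<lambda>s. indicator {c<..<d} s *\<^sub>R (indicator {- real (Suc N) <..< real (Suc N)} s * g s))
        = (\<lambda>s. indicator {max c (- B) <..< min d B} s *\<^sub>R g s)"
      unfolding B_def by (auto simp: indicator_def)
    then show "(LINT s:{c<..<d}|lborel. indicator {- real (Suc N) <..< real (Suc N)} s * g s) = 0"
      using 0[of "max c (- B)" "min d B"] by (simp add: set_lebesgue_integral_def)
  qed
  then have "AE s in lborel. \<forall>N. indicator {- real (Suc N) <..< real (Suc N)} s * g s = 0"
    by (subst AE_all_countable) (rule allI)
  then show ?thesis
  proof eventually_elim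
    case (elim s)
    obtain N where "\<bar>s\<bar> < real N" using reals_Archimedean2 by blast
    then have "s \<in> {- real (Suc N) <..< real (Suc N)}" by auto
    then show ?case using elim[rule_format, of N] by simp
  qed
qed

text \<open>
  Reduction to Borel functions, for which Fubini's theorem is applicable on the product of \<open>lborel\<close>
  with itself.
\<close>

lemma poisson_unique:
  fixes g :: "real \<Rightarrow> real"
  assumes gi: "integrable lebesgue (\<lambda>s. line_wt s * g s)"
    and zero: "\<And>v. Im v > 0 \<Longrightarrow> (LINT s|lebesgue. poisson v s * g s) = 0"
  shows "AE s in lebesgue. g s = 0"
proof -
  have "(\<lambda>s. line_wt s * g s) \<in> borel_measurable lebesgue" using gi by simp
  then have "(\<lambda>s. line_wt s * g s / line_wt s) \<in> borel_measurable lebesgue"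
    by (rule borel_measurable_divide) (intro measurable_completion, simp)
  then have gm: "g \<in> borel_measurable lebesgue"
    using line_wt_pos by (simp add: less_imp_neq[symmetric])
  then obtain h where h[measurable]: "h \<in> borel_measurable lborel" and eq: "AE s in lborel. g s = h s"
    using completion_ex_borel_measurable_real by blast
  have eq': "AE s in lebesgue. g s = h s" using eq by (rule AE_completion)
  have hm: "h \<in> borel_measurable lebesgue" using h by (rule measurable_completion)
  have wl: "line_wt \<in> borel_measurable lebesgue" and wp: "poisson v \<in> borel_measurable lebesgue" for v
    by (simp_all add: measurable_completion)
  have "AE s in lborel. h s = 0"
  proof (rule poisson_unique_borel)
    have "integrable lebesgue (\<lambda>s. line_wt s * h s)"
      using gi
    proof (rule integrable_cong_AE_imp)
      show "(\<lambda>s. line_wt s * h s) \<in> borel_measurable lebesgue"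
        by (rule borel_measurable_times[OF wl hm])
      show "AE s in lebesgue. line_wt s * g s = line_wt s * h s"
        using eq' by eventually_elim simp
    qed
    then show "integrable lborel (\<lambda>s. line_wt s * h s)"
      by (subst (asm) integrable_completion) auto
    fix v assume v: "Im v > 0"
    have "(LINT s|lborel. poisson v s * h s) = (LINT s|lebesgue. poisson v s * h s)"
      by (subst integral_completion) auto
    also have "\<dots> = (LINT s|lebesgue. poisson v s * g s)"
    proof (rule integral_cong_AE)
      show "AE s in lebesgue. poisson v s * h s = poisson v s * g s"
        using eq' by eventually_elim simp
    qed (rule borel_measurable_times[OF wp hm], rule borel_measurable_times[OF wp gm])
    finally show "(LINT s|lborel. poisson v s * h s) = 0" using zero[OF v] by simp
  qed simp
  then have "AE s in lebesgue. h s = 0" by (rule AE_completion)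
  with eq' show ?thesis by eventually_elim simp
qed

section \<open>Non-elliptic automorphisms and modulus invariance\<close>

text \<open>
  The exceptional set is the image of the original one under the inverse affine map, which is smooth
  and hence preserves null sets.
\<close>

lemma AE_affine:
  fixes P :: "real \<Rightarrow> bool"
  assumes "c \<noteq> 0" "AE x in lebesgue. P x"
  shows "AE x in lebesgue. P (c * x + d)"
proof -
  have "negligible {x. \<not> P x}"
    using assms(2) by (simp add: completion.AE_iff_null_sets negligible_iff_null_sets)
  then have "negligible ((\<lambda>x. (x - d) / c) ` {x. \<not> P x})"
    by (rule negligible_differentiable_image_negligible[rotated])
      (use assms(1) in \<open>auto simp: divide_inverse intro!: differentiable_on_mult differentiable_on_diff\<close>)
  also have "(\<lambda>x. (x - d) / c) ` {x. \<not> P x} = {x. \<not> P (c * x + d)}"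
    using assms(1) by (auto simp: image_iff intro!: exI[of _ "c * _ + d"])
  finally show ?thesis
    by (simp add: completion.AE_iff_null_sets negligible_iff_null_sets)
qed

lemma of_halfplane_ball:
  assumes "Im v > 0"
  shows "of_halfplane v \<in> ball 0 1"
proof -
  have "v + \<i> \<noteq> 0" using assms by (auto simp: complex_eq_iff)
  then have "Im v = (1 - (norm (of_halfplane v))\<^sup>2) / (norm (1 - of_halfplane v))\<^sup>2"
    using Im_to_halfplane[of "of_halfplane v"] by (simp add: to_of_halfplane)
  with assms have "0 < (1 - (norm (of_halfplane v))\<^sup>2) / (norm (1 - of_halfplane v))\<^sup>2" by simp
  then have "(norm (of_halfplane v))\<^sup>2 < 1" by (auto simp: zero_less_divide_iff)
  then show ?thesis by (simp add: abs_square_less_1)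
qed

lemma to_halfplane_line_pt: "to_halfplane (line_pt x) = of_real x"
  unfolding line_pt_def by (rule to_of_halfplane) (simp add: complex_eq_iff)

lemma holomorphic_const_norm:
  assumes "Q holomorphic_on ball 0 1" "\<And>z. z \<in> ball 0 1 \<Longrightarrow> norm (Q z) = r"
  obtains c where "norm c = r" "\<And>z. z \<in> ball 0 1 \<Longrightarrow> Q z = c"
proof -
  have "Q constant_on ball 0 1"
    by (rule maximum_modulus_principle[OF assms(1), of "ball 0 1" 0]) (use assms(2) in auto)
  then show ?thesis using that assms(2)[of 0] unfolding constant_on_def
    by (metis centre_in_ball zero_less_one)
qed

text \<open>
  The two kinds of automorphism are treated at once: \<open>b = 0\<close> is the hyperbolic case and \<open>a = 1\<close> the
  parabolic one. The disjunction makes \<open>n \<mapsto> a\<^sup>n x + n b\<close> an action of the integers.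
\<close>

locale disc_automorphism =
  fixes a b :: real and \<phi> :: "complex \<Rightarrow> complex"
  assumes a_ge_1: "a \<ge> 1" and ab: "a = 1 \<or> b = 0"
    and phi: "\<phi> = disc_conj (\<lambda>w. of_real a * w + of_real b)"
begin

definition T :: "int \<Rightarrow> real \<Rightarrow> real" where
  "T n x = a powi n * x + of_int n * b"

lemma a_pos: "a > 0" using a_ge_1 by simp

lemma T_add: "T (m + n) x = T m (T n x)"
  using ab a_pos by (auto simp: T_def power_int_add algebra_simps)

lemma T_0 [simp]: "T 0 x = x"
  by (simp add: T_def)

lemma T_1: "T 1 x = a * x + b"
  by (simp add: T_def)

lemma T_inverse [simp]: "T (- n) (T n x) = x" "T n (T (- n) x) = x"
  by (simp_all flip: T_add)

lemma Im_affine: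
  "Im (of_real a * v + of_real b) = a * Im v"
  by simp

lemma phi_of_halfplane:
  assumes "Im v > 0"
  shows "\<phi> (of_halfplane v) = of_halfplane (of_real a * v + of_real b)"
proof -
  have "of_halfplane v \<noteq> 1" using of_halfplane_ball[OF assms] by auto
  moreover have "v + \<i> \<noteq> 0" using assms by (auto simp: complex_eq_iff)
  ultimately show ?thesis by (simp add: phi disc_conj_def to_of_halfplane)
qed

lemma phi_ball: "z \<in> ball 0 1 \<Longrightarrow> \<phi> z \<in> ball 0 1"
  using phi_of_halfplane[of "to_halfplane z"] to_halfplane_ball[of z] a_pos
  by (metis Im_affine mult_pos_pos of_halfplane_ball)

lemma phi_surj_ball:
  assumes "z \<in> ball 0 1"
  obtains z' where "z' \<in> ball 0 1" "\<phi> z' = z"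
proof -
  define v where "v = (to_halfplane z - of_real b) / of_real a"
  have v: "Im v > 0" using to_halfplane_ball[OF assms] a_pos by (simp add: v_def)
  have "of_real a * v + of_real b = to_halfplane z" using a_pos by (simp add: v_def)
  then have "\<phi> (of_halfplane v) = z"
    using phi_of_halfplane[OF v] to_halfplane_ball[OF assms] by simp
  with of_halfplane_ball[OF v] show ?thesis by (rule that)
qed

lemma phi_holomorphic: "\<phi> holomorphic_on ball 0 1"
proof (rule holomorphic_transform)
  have "of_real a * (\<i> * (1 + z) / (1 - z)) + of_real b + \<i> \<noteq> 0" if "z \<in> ball 0 1" for z
  proof -
    have "Im (of_real a * to_halfplane z + of_real b + \<i>) > 0"
      using to_halfplane_ball(1)[OF that] a_pos by (simp add: add_pos_pos)
    then show ?thesis unfolding to_halfplane_def by (metis less_irrefl zero_complex.sel(2))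
  qed
  then show "(\<lambda>z. of_halfplane (of_real a * to_halfplane z + of_real b)) holomorphic_on ball 0 1"
    unfolding of_halfplane_def to_halfplane_def
    by (intro holomorphic_intros) auto
  show "of_halfplane (of_real a * to_halfplane z + of_real b) = \<phi> z" if "z \<in> ball 0 1" for z
    using that by (auto simp: phi disc_conj_def)
qed

lemma phi_line_pt: "\<phi> (line_pt x) = line_pt (T 1 x)"
  using line_pt_neq_1[of x]
  by (simp add: phi disc_conj_def to_halfplane_line_pt T_1) (simp add: line_pt_def)

lemma phi_inj: "inj_on \<phi> (cball 0 1)"
proof -
  have ne: "of_real a * to_halfplane z + of_real b + \<i> \<noteq> 0" if "z \<in> cball 0 1" for z
  proof -
    have "(norm z)\<^sup>2 \<le> 1" using that by (simp add: abs_square_le_1)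
    then have "Im (to_halfplane z) \<ge> 0" by (simp add: Im_to_halfplane)
    then have "Im (of_real a * to_halfplane z + of_real b + \<i>) > 0"
      using a_pos by (simp add: add_nonneg_pos)
    then show ?thesis by (metis less_irrefl zero_complex.sel(2))
  qed
  have n1: "of_halfplane u \<noteq> 1" for u
  proof
    assume "of_halfplane u = 1"
    then have "u - \<i> = u + \<i>" by (auto simp: of_halfplane_def divide_simps split: if_splits)
    then show False by (auto simp: complex_eq_iff)
  qed
  show ?thesis
  proof (rule inj_onI)
    fix z w assume z: "z \<in> cball 0 1" and w: "w \<in> cball 0 1" and eq: "\<phi> z = \<phi> w"
    show "z = w"
    proof (cases "z = 1 \<or> w = 1")
      case True
      then show ?thesis using eq n1 by (auto simp: phi disc_conj_def split: if_splits)
    next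
      case False
      then have "of_halfplane (of_real a * to_halfplane z + of_real b)
          = of_halfplane (of_real a * to_halfplane w + of_real b)"
        using eq by (simp add: phi disc_conj_def)
      then have "of_real a * to_halfplane z + of_real b = of_real a * to_halfplane w + of_real b"
        using to_of_halfplane ne z w by metis
      then have "to_halfplane z = to_halfplane w" using a_pos by simp
      then show ?thesis using of_to_halfplane False by metis
    qed
  qed
qed

lemma inv_phi_line_pt: "inv_into (cball 0 1) \<phi> (line_pt x) = line_pt (T (- 1) x)"
proof (rule inv_into_f_eq[OF phi_inj])
  show "line_pt (T (- 1) x) \<in> cball 0 1" by (simp add: norm_line_pt)
  show "\<phi> (line_pt (T (- 1) x)) = line_pt x" unfolding phi_line_pt using T_inverse(2)[of 1 x] by simp
qed

lemma int_iter_line_pt: "int_iter \<phi> n (line_pt x) = line_pt (T n x)"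
proof -
  have 1: "(\<phi> ^^ k) (line_pt x) = line_pt (T (int k) x)" for k
    by (induction k) (simp_all add: phi_line_pt flip: T_add)
  have 2: "(inv_into (cball 0 1) \<phi> ^^ k) (line_pt x) = line_pt (T (- int k) x)" for k
    by (induction k) (simp_all add: inv_phi_line_pt flip: T_add)
  show ?thesis unfolding int_iter_def using 1[of "nat n"] 2[of "nat (- n)"] by auto
qed

lemma AE_T:
  assumes "AE x in lebesgue. P x"
  shows "AE x in lebesgue. P (T n x)"
  unfolding T_def using a_pos by (intro AE_affine assms) simp

lemma poisson_affine: "a * poisson (of_real a * v + of_real b) (b + a * x) = poisson v x"
proof -
  have "(b + a * x - Re (of_real a * v + of_real b))\<^sup>2 + (Im (of_real a * v + of_real b))\<^sup>2
      = a\<^sup>2 * ((x - Re v)\<^sup>2 + (Im v)\<^sup>2)"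
    by (simp add: power2_eq_square algebra_simps)
  then show ?thesis unfolding poisson_def using a_pos by (simp add: power2_eq_square)
qed

lemma poisson_integral_affine:
  assumes "integrable lebesgue (\<lambda>x. poisson (of_real a * v + of_real b) x * u x)"
  shows "integrable lebesgue (\<lambda>x. poisson v x * u (T 1 x))"
    and "(LINT x|lebesgue. poisson (of_real a * v + of_real b) x * u x) = (LINT x|lebesgue. poisson v x * u (T 1 x))"
proof -
  let ?k = "\<lambda>x. poisson (of_real a * v + of_real b) x * u x"
  have e: "a * ?k (b + a * x) = poisson v x * u (T 1 x)" for x
    using poisson_affine[of v x] by (simp add: T_1 add.commute mult.assoc[symmetric])
  have "integrable lebesgue (\<lambda>x. a * ?k (b + a * x))"
    using lebesgue_integrable_real_affine[OF assms, of a b] a_pos by simp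
  then show "integrable lebesgue (\<lambda>x. poisson v x * u (T 1 x))" unfolding e .
  have "(LINT x|lebesgue. ?k x) = (LINT x|lebesgue. a * ?k (b + a * x))"
    using lebesgue_integral_real_affine[of a ?k b] a_pos by simp
  then show "(LINT x|lebesgue. ?k x) = (LINT x|lebesgue. poisson v x * u (T 1 x))" unfolding e .
qed

lemma eigen_outer_iff_norm:
  assumes u: "integrable arc_length (\<lambda>\<zeta>. ln (f \<zeta>))"
  shows "eigen_mod \<phi> 1 (outer_fun f) \<longleftrightarrow>
    (\<forall>z\<in>ball 0 1. norm (outer_fun f (\<phi> z)) = norm (outer_fun f z))"
proof
  assume "eigen_mod \<phi> 1 (outer_fun f)"
  then show "\<forall>z\<in>ball 0 1. norm (outer_fun f (\<phi> z)) = norm (outer_fun f z)"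
    by (auto simp: eigen_mod_def norm_mult)
next
  assume n: "\<forall>z\<in>ball 0 1. norm (outer_fun f (\<phi> z)) = norm (outer_fun f z)"
  let ?F = "outer_fun f"
  have nz: "?F z \<noteq> 0" for z by (simp add: outer_fun_def)
  have "(?F \<circ> \<phi>) holomorphic_on ball 0 1"
    using phi_ball by (intro holomorphic_on_compose_gen[OF phi_holomorphic outer_fun_holomorphic[OF u]]) auto
  then have "(\<lambda>z. ?F (\<phi> z) / ?F z) holomorphic_on ball 0 1"
    using outer_fun_holomorphic[OF u] nz by (intro holomorphic_intros) (auto simp: o_def)
  moreover have "norm (?F (\<phi> z) / ?F z) = 1" if "z \<in> ball 0 1" for z
    using n that nz by (simp add: norm_divide)
  ultimately obtain c where "norm c = 1" "\<And>z. z \<in> ball 0 1 \<Longrightarrow> ?F (\<phi> z) / ?F z = c"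
    by (rule holomorphic_const_norm) blast+
  then show "eigen_mod \<phi> 1 ?F"
    unfolding eigen_mod_def using nz by (intro bexI[of _ c]) (auto simp: field_simps)
qed

lemma eigen_outer_iff_invariant:
  assumes u: "integrable arc_length (\<lambda>\<zeta>. ln (f \<zeta>))" and pos: "AE \<zeta> in arc_length. f \<zeta> > 0"
  shows "eigen_mod \<phi> 1 (outer_fun f) \<longleftrightarrow> (AE x in lebesgue. f (line_pt (T 1 x)) = f (line_pt x))"
proof -
  let ?u = "\<lambda>x. ln (f (line_pt x))" and ?A = "\<lambda>v. of_real a * v + of_real b"
  let ?U = "\<lambda>v. LINT x|lebesgue. poisson v x * ?u x"
  have ip: "Im (?A v) > 0" if "Im v > 0" for v using that a_pos by simp
  have i1: "integrable lebesgue (\<lambda>x. poisson v x * ?u x)" if "Im v > 0" for v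
    by (rule norm_outer_fun(1)[OF u that of_halfplane_ball[OF that]])
  have i2: "integrable lebesgue (\<lambda>x. poisson v x * ?u (T 1 x))"
    and U2: "?U (?A v) = (LINT x|lebesgue. poisson v x * ?u (T 1 x))" if "Im v > 0" for v
    using poisson_integral_affine[OF i1[OF ip[OF that]]] by blast+
  have "(\<forall>z\<in>ball 0 1. norm (outer_fun f (\<phi> z)) = norm (outer_fun f z)) \<longleftrightarrow>
    (\<forall>v. Im v > 0 \<longrightarrow> norm (outer_fun f (\<phi> (of_halfplane v))) = norm (outer_fun f (of_halfplane v)))"
    by (metis of_halfplane_ball to_halfplane_ball)
  also have "\<dots> \<longleftrightarrow> (\<forall>v. Im v > 0 \<longrightarrow> ?U (?A v) = ?U v)"
  proof (intro all_cong1 imp_cong refl)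
    fix v assume v: "Im v > 0"
    show "norm (outer_fun f (\<phi> (of_halfplane v))) = norm (outer_fun f (of_halfplane v)) \<longleftrightarrow> ?U (?A v) = ?U v"
      unfolding phi_of_halfplane[OF v] norm_outer_fun(2)[OF u v of_halfplane_ball[OF v]]
        norm_outer_fun(2)[OF u ip[OF v] of_halfplane_ball[OF ip[OF v]]] by simp
  qed
  also have "\<dots> \<longleftrightarrow> (AE x in lebesgue. ?u (T 1 x) - ?u x = 0)"
  proof
    assume U: "\<forall>v. Im v > 0 \<longrightarrow> ?U (?A v) = ?U v"
    show "AE x in lebesgue. ?u (T 1 x) - ?u x = 0"
    proof (rule poisson_unique)
      \<comment> \<open>At \<open>\<i>\<close> the Poisson kernel is half of \<open>line_wt\<close>, so integrability against the latter is the case \<open>v = \<i>\<close>.\<close>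
      have "line_wt x * (?u (T 1 x) - ?u x) = 2 * (poisson \<i> x * ?u (T 1 x) - poisson \<i> x * ?u x)" for x
        by (simp add: line_wt_def poisson_def algebra_simps diff_divide_distrib)
      then show "integrable lebesgue (\<lambda>x. line_wt x * (?u (T 1 x) - ?u x))"
        using i1[of \<i>] i2[of \<i>] by simp
      fix v assume v: "Im v > 0"
      have "(LINT x|lebesgue. poisson v x * (?u (T 1 x) - ?u x)) = ?U (?A v) - ?U v"
        unfolding right_diff_distrib U2[OF v] using i1[OF v] i2[OF v] by simp
      then show "(LINT x|lebesgue. poisson v x * (?u (T 1 x) - ?u x)) = 0" using U v by simp
    qed
  next
    assume ae: "AE x in lebesgue. ?u (T 1 x) - ?u x = 0"
    show "\<forall>v. Im v > 0 \<longrightarrow> ?U (?A v) = ?U v"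
    proof (intro allI impI)
      fix v assume v: "Im v > 0"
      show "?U (?A v) = ?U v"
        unfolding U2[OF v]
      proof (rule integral_cong_AE)
        show "AE x in lebesgue. poisson v x * ?u (T 1 x) = poisson v x * ?u x"
          using ae by eventually_elim simp
      qed (use i1[OF v] i2[OF v] in auto)
    qed
  qed
  also have "\<dots> \<longleftrightarrow> (AE x in lebesgue. f (line_pt (T 1 x)) = f (line_pt x))"
  proof -
    have p: "AE x in lebesgue. f (line_pt x) > 0" using pos by (simp add: arc_length_AE)
    have "AE x in lebesgue. ?u (T 1 x) - ?u x = 0 \<longleftrightarrow> f (line_pt (T 1 x)) = f (line_pt x)"
      using p AE_T[OF p, of 1] by eventually_elim (simp add: ln_inj_iff)
    then show ?thesis by (rule eventually_subst)
  qed
  finally show ?thesis unfolding eigen_outer_iff_norm[OF u] .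
qed

text \<open>
  Along the forward orbit of \<open>0\<close> the modulus of \<open>F\<close> is multiplied by \<open>lam\<close> at every step, along the
  backward orbit by \<open>1 / lam\<close>. Unless \<open>lam = 1\<close>, one of the two contradicts boundedness.
\<close>

lemma eigen_mod_lambda:
  assumes F: "bounded (F ` ball 0 1)" and nz: "F 0 \<noteq> 0" and lam: "lam > 0" and e: "eigen_mod \<phi> lam F"
  shows "lam = 1"
proof -
  have n: "norm (F (\<phi> z)) = lam * norm (F z)" if "z \<in> ball 0 1" for z
    using e that lam by (auto simp: eigen_mod_def norm_mult)
  obtain C where C: "\<And>z. z \<in> ball 0 1 \<Longrightarrow> norm (F z) \<le> C"
    using F unfolding bounded_iff by blast
  have fwd: "\<exists>z'\<in>ball 0 1. norm (F z') = lam ^ k * norm (F 0)" for k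
    by (induction k) (use n phi_ball in \<open>auto intro: bexI[of _ 0]\<close>, metis mem_ball_0 mult.assoc)
  have bwd: "\<exists>z'\<in>ball 0 1. norm (F 0) = lam ^ k * norm (F z')" for k
  proof (induction k)
    case (Suc k)
    then obtain z' where z': "z' \<in> ball 0 1" "norm (F 0) = lam ^ k * norm (F z')" by blast
    then obtain z where "z \<in> ball 0 1" "\<phi> z = z'" using phi_surj_ball by blast
    then show ?case using z' n[of z] by (intro bexI[of _ z]) auto
  qed (auto intro: bexI[of _ 0])
  have pos: "norm (F 0) > 0" using nz by simp
  have "C > 0" using C[of 0] pos by (simp del: zero_less_norm_iff)
  have "\<not> lam > 1"
  proof
    assume "lam > 1"
    then obtain k where "C / norm (F 0) < lam ^ k" using real_arch_pow by blast
    then show False using fwd[of k] C pos by (metis linorder_not_less pos_divide_less_eq)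
  qed
  moreover have "\<not> lam < 1"
  proof
    assume "lam < 1"
    then obtain k where k: "lam ^ k < norm (F 0) / C"
      using real_arch_pow_inv[of "norm (F 0) / C" lam] pos \<open>C > 0\<close> by auto
    obtain z' where z': "z' \<in> ball 0 1" "norm (F 0) = lam ^ k * norm (F z')" using bwd by blast
    have "norm (F 0) \<le> lam ^ k * C" unfolding z'(2) using C[OF z'(1)] lam by (intro mult_left_mono) auto
    also have "\<dots> < norm (F 0)" using k \<open>C > 0\<close> by (simp add: pos_less_divide_eq)
    finally show False by simp
  qed
  ultimately show ?thesis by simp
qed

end

section \<open>Fundamental domains and spread weights\<close>

text \<open>
  \<open>I\<close> is \<open>J\<close> in the coordinate of the line, a fundamental domain up to null sets. The sequence \<open>\<kappa>\<close>
  controls the size of the tiles relative to \<open>I\<close>: on \<open>I\<close>, the density of arc length pulled back by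
  \<open>T n\<close> is at most \<open>\<kappa>\<close> times the original one. The integers are enumerated as \<open>i\<close> and \<open>-1 - i\<close> for
  natural \<open>i\<close>, so that only sums over natural numbers occur.
\<close>

locale tiled_automorphism = disc_automorphism a b \<phi> for a b :: real and \<phi> :: "complex \<Rightarrow> complex" +
  fixes I :: "real set" and J :: "complex set" and \<kappa> :: "nat \<Rightarrow> real"
  assumes J: "J = line_pt ` I" and I_borel: "I \<in> sets borel"
    and disjoint: "\<And>m n y y'. y \<in> I \<Longrightarrow> y' \<in> I \<Longrightarrow> T m y = T n y' \<Longrightarrow> m = n"
    and cover: "AE x in lebesgue. \<exists>n. \<exists>y\<in>I. x = T n y"
    and summable_\<kappa>: "summable \<kappa>"
    and \<kappa>: "\<And>i y. y \<in> I \<Longrightarrow> a powi int i * line_wt (T (int i) y) \<le> \<kappa> i * line_wt y"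
      "\<And>i y. y \<in> I \<Longrightarrow> a powi (- 1 - int i) * line_wt (T (- 1 - int i) y) \<le> \<kappa> i * line_wt y"
begin

lemma line_pt_mem_J: "line_pt x \<in> J \<longleftrightarrow> x \<in> I"
  using line_pt_inj by (auto simp: J dest: injD)

lemma line_pt_mem_tile: "line_pt x \<in> int_iter \<phi> n ` J \<longleftrightarrow> T (- n) x \<in> I"
proof
  assume "line_pt x \<in> int_iter \<phi> n ` J"
  then obtain y where "y \<in> I" "line_pt x = line_pt (T n y)"
    by (auto simp: J int_iter_line_pt)
  then show "T (- n) x \<in> I" using line_pt_inj by (auto dest: injD)
next
  assume "T (- n) x \<in> I"
  then have "int_iter \<phi> n (line_pt (T (- n) x)) \<in> int_iter \<phi> n ` J" by (simp add: J)
  then show "line_pt x \<in> int_iter \<phi> n ` J" by (simp add: int_iter_line_pt)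
qed

lemma tile_unique:
  assumes "y \<in> I"
  shows "T (- m) (T n y) \<in> I \<longleftrightarrow> m = n"
proof
  assume "T (- m) (T n y) \<in> I"
  then show "m = n" using disjoint[OF _ assms, of "T (- m) (T n y)" m n] by simp
qed (use assms in simp)

lemma spread_tile:
  assumes "y \<in> I"
  shows "spread \<phi> J f0 (line_pt (T n y)) = f0 (line_pt y)"
proof -
  have "spread \<phi> J f0 (line_pt (T n y)) = (\<Sum>\<^sub>\<infinity>m::int. if m = n then f0 (line_pt y) else 0)"
    unfolding spread_def
    by (intro infsum_cong) (auto simp: indicator_def line_pt_mem_tile tile_unique[OF assms] int_iter_line_pt)
  also have "\<dots> = (\<Sum>\<^sub>\<infinity>m\<in>{n}. f0 (line_pt y))"
    by (rule infsum_cong_neutral) auto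
  finally show ?thesis by simp
qed

lemma spread_nonneg:
  assumes "\<forall>\<zeta>\<in>J. f0 \<zeta> \<ge> 0"
  shows "spread \<phi> J f0 z \<ge> 0"
  unfolding spread_def
proof (rule infsum_nonneg)
  fix n :: int
  have "f0 (int_iter \<phi> (- n) z) \<ge> 0" if "z \<in> int_iter \<phi> n ` J"
  proof -
    from that obtain y where "y \<in> I" "z = line_pt (T n y)" by (auto simp: J int_iter_line_pt)
    then show ?thesis using assms by (auto simp: int_iter_line_pt J)
  qed
  then show "indicator (int_iter \<phi> n ` J) z * f0 (int_iter \<phi> (- n) z) \<ge> 0"
    by (simp add: indicator_def)
qed

lemma J_sets: "J \<in> sets arc_length" and J_sphere: "J \<subseteq> sphere 0 1"
proof -
  show s: "J \<subseteq> sphere 0 1" by (auto simp: J norm_line_pt)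
  have "line_pt -` J = I" using line_pt_mem_J by auto
  moreover have "I \<in> sets lebesgue" using I_borel by (simp add: sets_completionI_sets)
  ultimately have "J \<inter> sphere 0 1 \<in> sets arc_length" by (simp add: arc_length_indicator)
  with s show "J \<in> sets arc_length" by (simp add: Int_absorb2)
qed

lemma weight_on_J:
  assumes "weight_on J f0"
  shows "\<exists>C. AE x in lebesgue. x \<in> I \<longrightarrow> \<bar>f0 (line_pt x)\<bar> \<le> C"
    and "AE x in lebesgue. x \<in> I \<longrightarrow> f0 (line_pt x) > 0"
    and "integrable lebesgue (\<lambda>x. line_wt x * (indicator I x * ln (f0 (line_pt x))))"
proof -
  have J': "J \<inter> space arc_length \<in> sets arc_length" using J_sets by auto
  show "\<exists>C. AE x in lebesgue. x \<in> I \<longrightarrow> \<bar>f0 (line_pt x)\<bar> \<le> C"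
    using assms unfolding weight_on_def ess_bounded_def AE_restrict_space_iff[OF J'] arc_length_AE line_pt_mem_J
    by blast
  show "AE x in lebesgue. x \<in> I \<longrightarrow> f0 (line_pt x) > 0"
    using assms unfolding weight_on_def log_integrable_def AE_restrict_space_iff[OF J'] arc_length_AE line_pt_mem_J
    by blast
  have "integrable arc_length (\<lambda>\<zeta>. indicator J \<zeta> *\<^sub>R ln (f0 \<zeta>))"
    using assms unfolding weight_on_def log_integrable_def integrable_restrict_space[OF J'] by blast
  then show "integrable lebesgue (\<lambda>x. line_wt x * (indicator I x * ln (f0 (line_pt x))))"
    unfolding arc_length_line(1) by (simp add: indicator_def line_pt_mem_J)
qed

lemma weight_on_restrict:
  assumes "weight_on (sphere 0 1) f"
  shows "weight_on J f"
proof -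
  have J': "J \<inter> space arc_length \<in> sets arc_length" using J_sets by auto
  have f: "\<forall>\<zeta>\<in>sphere 0 1. f \<zeta> \<ge> 0" "f \<in> borel_measurable arc_length" "AE \<zeta> in arc_length. f \<zeta> > 0"
    "integrable arc_length (\<lambda>\<zeta>. ln (f \<zeta>))"
    using assms by (auto simp: weight_on_sphere)
  obtain C where C: "AE \<zeta> in arc_length. \<bar>f \<zeta>\<bar> \<le> C"
    using assms unfolding weight_on_def ess_bounded_def restrict_space_arc_length by blast
  have "integrable (restrict_space arc_length J) (\<lambda>\<zeta>. ln (f \<zeta>))"
    unfolding integrable_restrict_space[OF J'] using J_sets f(4) by (rule integrable_mult_indicator)
  moreover have "AE \<zeta> in restrict_space arc_length J. f \<zeta> > 0"
    using f(3) unfolding AE_restrict_space_iff[OF J'] by eventually_elim simp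
  moreover have "AE \<zeta> in restrict_space arc_length J. \<bar>f \<zeta>\<bar> \<le> C"
    using C unfolding AE_restrict_space_iff[OF J'] by eventually_elim simp
  ultimately show ?thesis
    using f J_sphere unfolding weight_on_def ess_bounded_def log_integrable_def
    by (auto intro: measurable_restrict_space1)
qed

text \<open>
  If \<open>f\<close> is invariant, it is the spread of its own restriction to \<open>J\<close>. Invariance holds outside a null
  set simultaneously for all the countably many iterates.
\<close>

lemma invariant_iff_spread:
  assumes f: "weight_on (sphere 0 1) f"
  shows "(AE x in lebesgue. f (line_pt (T 1 x)) = f (line_pt x)) \<longleftrightarrow>
    (\<exists>f0. weight_on J f0 \<and> (AE z in arc_length. f z = spread \<phi> J f0 z))"
proof
  assume inv: "AE x in lebesgue. f (line_pt (T 1 x)) = f (line_pt x)"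
  have nat: "AE x in lebesgue. f (line_pt (T (int k) x)) = f (line_pt x)" for k
  proof (induction k)
    case (Suc k)
    have "AE x in lebesgue. f (line_pt (T 1 (T (int k) x))) = f (line_pt (T (int k) x))"
      by (rule AE_T[OF inv])
    with Suc show ?case by eventually_elim (simp flip: T_add)
  qed simp
  have int: "AE x in lebesgue. f (line_pt (T n x)) = f (line_pt x)" for n
  proof (cases "n \<ge> 0")
    case True
    then show ?thesis using nat[of "nat n"] by simp
  next
    case False
    have "AE x in lebesgue. f (line_pt (T (int (nat (- n))) (T n x))) = f (line_pt (T n x))"
      by (rule AE_T[OF nat])
    then show ?thesis using False by (simp add: eq_commute)
  qed
  have "AE x in lebesgue. \<forall>n. f (line_pt (T n x)) = f (line_pt x)"
    using int by (subst AE_all_countable) blast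
  then have "AE x in lebesgue. f (line_pt x) = spread \<phi> J f (line_pt x)"
    using cover
  proof eventually_elim
    case (elim x)
    then obtain n y where y: "y \<in> I" "x = T n y" by blast
    have "f (line_pt (T (- n) x)) = f (line_pt x)" using elim(1) by blast
    then show ?case using y spread_tile[OF y(1)] by simp
  qed
  then show "\<exists>f0. weight_on J f0 \<and> (AE z in arc_length. f z = spread \<phi> J f0 z)"
    using weight_on_restrict[OF f] arc_length_AE by blast
next
  assume "\<exists>f0. weight_on J f0 \<and> (AE z in arc_length. f z = spread \<phi> J f0 z)"
  then obtain f0 where "AE x in lebesgue. f (line_pt x) = spread \<phi> J f0 (line_pt x)"
    unfolding arc_length_AE by blast
  with AE_T[OF this, of 1] cover
  show "AE x in lebesgue. f (line_pt (T 1 x)) = f (line_pt x)"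
  proof eventually_elim
    case (elim x)
    then obtain n y where y: "y \<in> I" "x = T n y" by blast
    have "T 1 x = T (1 + n) y" by (simp add: y T_add)
    then show ?case using elim y spread_tile[OF y(1)] by simp
  qed
qed

text \<open>
  Substitution of \<open>T n y\<close> for \<open>x\<close> turns the integral over the \<open>n\<close>-th tile into one over \<open>I\<close>.
\<close>

lemma tile_term_bound:
  assumes q: "integrable lebesgue (\<lambda>x. line_wt x * q x)" and q0: "\<And>x. x \<notin> I \<Longrightarrow> q x = 0"
    and K: "\<And>y. y \<in> I \<Longrightarrow> a powi n * line_wt (T n y) \<le> K * line_wt y"
  shows "integrable lebesgue (\<lambda>x. line_wt x * q (T (- n) x))"
    and "(LINT x|lebesgue. \<bar>line_wt x * q (T (- n) x)\<bar>) \<le> K * (LINT x|lebesgue. \<bar>line_wt x * q x\<bar>)"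
proof -
  define c where "c = a powi n"
  have c: "c > 0" using a_pos by (simp add: c_def)
  have Tc: "T n y = of_int n * b + c * y" for y by (simp add: T_def c_def)
  have wm: "line_wt \<in> borel_measurable lebesgue" by (simp add: measurable_completion)
  have "(\<lambda>x. line_wt x * q x / line_wt x) \<in> borel_measurable lebesgue"
    by (rule borel_measurable_divide[OF borel_measurable_integrable[OF q] wm])
  then have qm: "q \<in> borel_measurable lebesgue"
    using line_wt_pos by (simp add: less_imp_neq[symmetric])
  have wTm: "(\<lambda>y. line_wt (T n y)) \<in> borel_measurable lebesgue"
  proof (rule measurable_completion)
    have "(\<lambda>y. line_wt (T n y)) \<in> borel_measurable borel" unfolding T_def by measurable
    then show "(\<lambda>y. line_wt (T n y)) \<in> borel_measurable lborel" by simp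
  qed
  let ?g = "\<lambda>y. c * (line_wt (T n y) * q y)"
  have bnd: "\<bar>?g y\<bar> \<le> K * \<bar>line_wt y * q y\<bar>" for y
  proof (cases "y \<in> I")
    case True
    then have "c * line_wt (T n y) * \<bar>q y\<bar> \<le> K * line_wt y * \<bar>q y\<bar>"
      unfolding c_def by (intro mult_right_mono K) auto
    then show ?thesis using c line_wt_pos by (simp add: abs_mult abs_of_pos mult.assoc)
  qed (simp add: q0)
  have Kq: "integrable lebesgue (\<lambda>y. K * \<bar>line_wt y * q y\<bar>)" using q by simp
  have gi: "integrable lebesgue ?g"
  proof (rule Bochner_Integration.integrable_bound[OF Kq])
    show "?g \<in> borel_measurable lebesgue"
      by (intro borel_measurable_times wTm qm) simp
    have "norm (?g y) \<le> norm (K * \<bar>line_wt y * q y\<bar>)" for y using bnd[of y] by simp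
    then show "AE y in lebesgue. norm (?g y) \<le> norm (K * \<bar>line_wt y * q y\<bar>)" by simp
  qed
  let ?h = "\<lambda>x. line_wt x * q (T (- n) x)"
  have e: "?h (of_int n * b + c * y) = line_wt (T n y) * q y" for y
    unfolding Tc[symmetric] by simp
  have "integrable lebesgue (\<lambda>y. ?h (of_int n * b + c * y))"
    unfolding e using gi c by simp
  then show "integrable lebesgue ?h"
    using c by (subst (asm) lebesgue_integrable_real_affine_iff) auto
  have "(LINT x|lebesgue. \<bar>?h x\<bar>) = c * (LINT y|lebesgue. \<bar>?h (of_int n * b + c * y)\<bar>)"
    using lebesgue_integral_real_affine[of c "\<lambda>x. \<bar>?h x\<bar>" "of_int n * b"] c by simp
  also have "\<dots> = (LINT y|lebesgue. \<bar>?g y\<bar>)"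
    unfolding e using c by (simp add: abs_mult mult.assoc)
  also have "\<dots> \<le> (LINT y|lebesgue. K * \<bar>line_wt y * q y\<bar>)"
    by (rule integral_mono) (use gi Kq bnd in auto)
  also have "\<dots> = K * (LINT x|lebesgue. \<bar>line_wt x * q x\<bar>)" by simp
  finally show "(LINT x|lebesgue. \<bar>?h x\<bar>) \<le> K * (LINT x|lebesgue. \<bar>line_wt x * q x\<bar>)" .
qed

text \<open>
  Almost everywhere exactly one tile contains \<open>x\<close>, so \<open>line_wt * s\<close> is the pointwise sum of the
  terms of \<open>tile_term_bound\<close>; these are absolutely summable in the mean because \<open>\<kappa>\<close> is summable.
\<close>

lemma spread_integrable:
  assumes q: "integrable lebesgue (\<lambda>x. line_wt x * q x)" and q0: "\<And>x. x \<notin> I \<Longrightarrow> q x = 0"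
    and s: "\<And>n y. y \<in> I \<Longrightarrow> s (T n y) = q y"
  shows "integrable lebesgue (\<lambda>x. line_wt x * s x)"
proof -
  let ?t = "\<lambda>n x. line_wt x * q (T (- n) x)"
  let ?f = "\<lambda>i x. ?t (int i) x + ?t (- 1 - int i) x"
  let ?Q = "LINT x|lebesgue. \<bar>line_wt x * q x\<bar>"
  note t1 = tile_term_bound[OF q q0 \<kappa>(1)] and t2 = tile_term_bound[OF q q0 \<kappa>(2)]
  have fi: "integrable lebesgue (?f i)" for i
    by (intro Bochner_Integration.integrable_add t1(1) t2(1))
  have nf: "(LINT x|lebesgue. norm (?f i x)) \<le> 2 * ?Q * \<kappa> i" for i
  proof -
    have "(LINT x|lebesgue. norm (?f i x)) \<le> (LINT x|lebesgue. \<bar>?t (int i) x\<bar> + \<bar>?t (- 1 - int i) x\<bar>)"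
      using fi t1(1) t2(1) by (intro integral_mono integrable_norm) (auto intro!: Bochner_Integration.integrable_add)
    also have "\<dots> = (LINT x|lebesgue. \<bar>?t (int i) x\<bar>) + (LINT x|lebesgue. \<bar>?t (- 1 - int i) x\<bar>)"
      using t1(1) t2(1) by (intro Bochner_Integration.integral_add integrable_abs) auto
    also have "\<dots> \<le> \<kappa> i * ?Q + \<kappa> i * ?Q" by (intro add_mono t1(2) t2(2))
    finally show ?thesis by (simp add: algebra_simps)
  qed
  have sums: "AE x in lebesgue. \<exists>j. \<forall>i. ?f i x = (if i = j then line_wt x * s x else 0)"
    using cover
  proof eventually_elim
    case (elim x)
    then obtain n y where y: "y \<in> I" "x = T n y" by blast
    have t: "?t m x = (if m = n then line_wt x * s x else 0)" for m
      using tile_unique[OF y(1), of m n] y s[OF y(1)] q0 by auto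
    show ?case
    proof (intro exI allI)
      fix i
      \<comment> \<open>The tile index \<open>n\<close> occurs at position \<open>n\<close> of the enumeration if \<open>n \<ge> 0\<close>, and at \<open>-1 - n\<close> otherwise.\<close>
      show "?f i x = (if i = (if n \<ge> 0 then nat n else nat (- 1 - n)) then line_wt x * s x else 0)"
        unfolding t by auto
    qed
  qed
  have "integrable lebesgue (\<lambda>x. \<Sum>i. ?f i x)"
  proof (rule integrable_suminf[OF fi])
    show "AE x in lebesgue. summable (\<lambda>i. norm (?f i x))"
      using sums
    proof eventually_elim
      case (elim x)
      then obtain j where "\<forall>i. ?f i x = (if i = j then line_wt x * s x else 0)" by blast
      then show ?case by (intro summable_finite[of "{j}"]) auto
    qed
    show "summable (\<lambda>i. LINT x|lebesgue. norm (?f i x))"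
      by (rule summable_comparison_test'[OF summable_mult[OF summable_\<kappa>, of "2 * ?Q"], of 0])
        (use nf in simp)
  qed
  moreover have ae: "AE x in lebesgue. (\<Sum>i. ?f i x) = line_wt x * s x"
    using sums
  proof eventually_elim
    case (elim x)
    then obtain j where j: "\<forall>i. ?f i x = (if i = j then line_wt x * s x else 0)" by blast
    have "(\<lambda>i. ?f i x) sums (line_wt x * s x)"
      unfolding j[rule_format] using sums_single[of j "\<lambda>_. line_wt x * s x"] by simp
    then show ?case by (simp add: sums_iff)
  qed
  moreover from calculation have "(\<lambda>x. line_wt x * s x) \<in> borel_measurable lebesgue"
    by (intro borel_measurable_AE[OF borel_measurable_integrable ae])
  ultimately show ?thesis
    by (elim integrable_cong_AE_imp) (auto elim!: eventually_mono)
qed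

text \<open>
  Measurability of the spread is recovered from that of its logarithm: Lebesgue measure is complete
  and the spread is almost everywhere positive.
\<close>

lemma spread_weight:
  assumes f0: "weight_on J f0"
  shows "weight_on (sphere 0 1) (spread \<phi> J f0)"
proof -
  let ?S = "\<lambda>x. spread \<phi> J f0 (line_pt x)"
  obtain C where C: "AE x in lebesgue. x \<in> I \<longrightarrow> \<bar>f0 (line_pt x)\<bar> \<le> C"
    using weight_on_J(1)[OF f0] by blast
  have transfer: "AE x in lebesgue. P (?S x)" if "AE x in lebesgue. x \<in> I \<longrightarrow> P (f0 (line_pt x))" for P
  proof -
    have "AE x in lebesgue. \<forall>n. T (- n) x \<in> I \<longrightarrow> P (f0 (line_pt (T (- n) x)))"
      by (subst AE_all_countable) (intro allI AE_T[OF that])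
    with cover show ?thesis
    proof eventually_elim
      case (elim x)
      then obtain n y where y: "y \<in> I" "x = T n y" by blast
      then show ?case using elim(2)[rule_format, of n] spread_tile[OF y(1)] by simp
    qed
  qed
  have pos: "AE x in lebesgue. ?S x > 0" by (rule transfer[OF weight_on_J(2)[OF f0]])
  have bnd: "AE x in lebesgue. \<bar>?S x\<bar> \<le> C" by (rule transfer[OF C])
  have ln: "integrable lebesgue (\<lambda>x. line_wt x * ln (?S x))"
    by (rule spread_integrable[OF weight_on_J(3)[OF f0]]) (simp_all add: spread_tile)
  have wm: "line_wt \<in> borel_measurable lebesgue" by (simp add: measurable_completion)
  have "(\<lambda>x. line_wt x * ln (?S x) / line_wt x) \<in> borel_measurable lebesgue"
    by (rule borel_measurable_divide[OF borel_measurable_integrable[OF ln] wm])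
  then have "(\<lambda>x. ln (?S x)) \<in> borel_measurable lebesgue"
    using line_wt_pos by (simp add: less_imp_neq[symmetric])
  then have "(\<lambda>x. exp (ln (?S x))) \<in> borel_measurable lebesgue" by measurable
  then have Sm: "?S \<in> borel_measurable lebesgue"
    by (rule borel_measurable_AE) (use pos in \<open>eventually_elim, simp\<close>)
  have "integrable lebesgue (\<lambda>x. line_wt x * ?S x)"
  proof (rule Bochner_Integration.integrable_bound)
    show "integrable lebesgue (\<lambda>x. C * line_wt x)" using line_wt_integrable by simp
    show "(\<lambda>x. line_wt x * ?S x) \<in> borel_measurable lebesgue" by (rule borel_measurable_times[OF wm Sm])
    show "AE x in lebesgue. norm (line_wt x * ?S x) \<le> norm (C * line_wt x)"
      using bnd
    proof eventually_elim
      case (elim x)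
      have "line_wt x * \<bar>?S x\<bar> \<le> line_wt x * \<bar>C\<bar>"
        using elim line_wt_pos[of x] by (intro mult_left_mono) auto
      then show ?case using line_wt_pos[of x] by (simp add: abs_mult mult.commute)
    qed
  qed
  then have "integrable arc_length (spread \<phi> J f0)" unfolding arc_length_line(1) .
  then have "spread \<phi> J f0 \<in> borel_measurable arc_length" by simp
  moreover have "integrable arc_length (\<lambda>\<zeta>. ln (spread \<phi> J f0 \<zeta>))"
    using ln unfolding arc_length_line(1) .
  moreover have "AE \<zeta> in arc_length. spread \<phi> J f0 \<zeta> > 0" using pos unfolding arc_length_AE .
  moreover have "AE \<zeta> in arc_length. spread \<phi> J f0 \<zeta> \<le> C"
    unfolding arc_length_AE using bnd by eventually_elim simp
  moreover have "\<forall>\<zeta>\<in>sphere 0 1. spread \<phi> J f0 \<zeta> \<ge> 0"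
    using f0 spread_nonneg unfolding weight_on_def by blast
  ultimately show ?thesis unfolding weight_on_sphere by blast
qed

lemma eigen_iff_spread:
  assumes "is_outer f F"
  shows "eigen_mod \<phi> 1 F \<longleftrightarrow> (\<exists>f0. weight_on J f0 \<and> (AE z in arc_length. f z = spread \<phi> J f0 z))"
proof -
  have f: "weight_on (sphere 0 1) f" and F: "\<forall>z\<in>ball 0 1. F z = outer_fun f z"
    using assms by (auto simp: is_outer_def)
  have "eigen_mod \<phi> 1 F \<longleftrightarrow> eigen_mod \<phi> 1 (outer_fun f)"
    unfolding eigen_mod_def using F phi_ball by simp
  then show ?thesis
    using eigen_outer_iff_invariant[of f] invariant_iff_spread[OF f] f weight_on_sphere by blast
qed

lemma eigen_lambda_eq_1:
  assumes "is_outer f F" "eigen_mod \<phi> lam F" "lam > 0"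
  shows "lam = 1"
proof (rule eigen_mod_lambda[OF _ _ assms(3,2)])
  show "bounded (F ` ball 0 1)" using assms(1) unfolding is_outer_def H_inf_def by blast
  show "F 0 \<noteq> 0" using assms(1) by (simp add: is_outer_def outer_fun_def)
qed

lemma eigen_characterization:
  assumes "lam > 0"
  shows "((\<exists>f F. is_outer f F \<and> eigen_mod \<phi> lam F) \<longleftrightarrow> lam = 1) \<and>
         (lam = 1 \<longrightarrow>
           (\<forall>f F. is_outer f F \<longrightarrow>
              (eigen_mod \<phi> lam F \<longleftrightarrow>
               (\<exists>f0. weight_on J f0 \<and> (AE z in arc_length. f z = spread \<phi> J f0 z)))) \<and>
           (\<forall>f0. weight_on J f0 \<longrightarrow> (\<exists>F. is_outer (spread \<phi> J f0) F)))"
proof -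
  have "weight_on (sphere 0 1) (\<lambda>_. 1)"
    unfolding weight_on_sphere by (auto intro: exI[of _ 1])
  then have "is_outer (\<lambda>_. 1) (outer_fun (\<lambda>_. 1))" by (rule is_outer_outer_fun)
  moreover have "eigen_mod \<phi> 1 (outer_fun (\<lambda>_. 1))"
    unfolding eigen_mod_def by (intro bexI[of _ 1]) (auto simp: outer_fun_arc_length)
  ultimately show ?thesis
    using eigen_lambda_eq_1 assms eigen_iff_spread spread_weight is_outer_outer_fun by blast
qed

end

section \<open>The hyperbolic and the parabolic case\<close>

lemma eq_line_pt_image:
  assumes "to_halfplane ` J = of_real ` I" "1 \<notin> J"
  shows "J = line_pt ` I"
proof -
  have "J = (\<lambda>z. of_halfplane (to_halfplane z)) ` J"
    using assms(2) of_to_halfplane by (metis (no_types, lifting) image_cong image_ident)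
  also have "\<dots> = of_halfplane ` of_real ` I" by (simp add: image_image flip: assms(1))
  finally show ?thesis by (simp add: image_image line_pt_def)
qed

lemma hyp_J_line_pt:
  assumes "\<alpha> > 1"
  shows "hyp_J \<alpha> = line_pt ` ({- \<alpha> <.. - 1} \<union> {1 ..< \<alpha>})"
proof (rule eq_line_pt_image[OF to_halfplane_hyp_J[OF assms]])
  show "1 \<notin> hyp_J \<alpha>"
  proof
    assume "1 \<in> hyp_J \<alpha>"
    then have "to_halfplane 1 \<in> of_real ` ({- \<alpha> <.. - 1} \<union> {1 ..< \<alpha>})"
      using to_halfplane_hyp_J[OF assms] by blast
    then show False by (auto simp: to_halfplane_def)
  qed
qed

lemma par_J_line_pt:
  assumes "t > 0"
  shows "par_J t = line_pt ` {0 ..< t}"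
proof (rule eq_line_pt_image[OF to_halfplane_par_J[OF assms]])
  have "par_aut t (- 1) = of_halfplane (of_real t)"
    by (simp add: par_aut_def disc_conj_def to_halfplane_def)
  then have A: "Arg (par_aut t (- 1)) < 0"
    using assms arctan_ubound[of t] by (simp add: Arg_of_halfplane_pos)
  show "1 \<notin> par_J t"
  proof
    assume "1 \<in> par_J t"
    then obtain \<theta> where th: "cis \<theta> = 1" "- pi \<le> \<theta>" "\<theta> < 0"
      using A by (auto simp: par_J_def)
    then have "\<theta> \<noteq> - pi" by (auto simp: complex_eq_iff)
    then have "Arg (cis \<theta>) = \<theta>" using th pi_gt_zero by (intro Arg_cis) auto
    with th show False by simp
  qed
qed

lemma powi_scale_not_less:
  assumes "\<alpha> > 1" "1 \<le> u'" "u < \<alpha>" "\<alpha> powi m * u = \<alpha> powi n * (u' :: real)"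
  shows "\<not> m < n"
proof
  assume "m < n"
  have "\<alpha> powi m * u < \<alpha> powi m * \<alpha>" using assms(1,3) by (intro mult_strict_left_mono) auto
  also have "\<dots> = \<alpha> powi (m + 1)" using assms by (simp add: power_int_add)
  also have "\<dots> \<le> \<alpha> powi n" using assms \<open>m < n\<close> by (intro power_int_increasing) auto
  also have "\<dots> \<le> \<alpha> powi n * u'" using assms by simp
  finally show False using assms by simp
qed

lemma powi_scale_exists:
  assumes "\<alpha> > 1" "x > (0 :: real)"
  shows "\<exists>n. \<alpha> powi n \<le> x \<and> x < \<alpha> powi (n + 1)"
proof -
  define n where "n = \<lfloor>log \<alpha> x\<rfloor>"
  have "\<alpha> powr (real_of_int n) \<le> x" "x < \<alpha> powr (real_of_int (n + 1))"
    using assms powr_le_cancel_iff[of \<alpha> n "log \<alpha> x"] powr_less_cancel_iff[of \<alpha> "log \<alpha> x" "n + 1"]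
    by (auto simp: n_def powr_log_cancel)
  moreover have "\<alpha> powr (real_of_int k) = \<alpha> powi k" for k
    using assms by (intro powr_real_of_int') auto
  ultimately show ?thesis by metis
qed

text \<open>
  With \<open>A = \<alpha>\<^sup>i\<close>, the pulled-back density is \<open>2 A / (1 + A\<^sup>2 y\<^sup>2) \<le> 2 / (A y\<^sup>2)\<close> for positive exponents and at
  most \<open>2 / A\<close> for negative ones, while \<open>1 \<le> y\<^sup>2 \<le> \<alpha>\<^sup>2\<close> on the fundamental domain. The
  latter stays away from \<open>0\<close> and from infinity, which correspond to the fixed points.
\<close>

lemma tiled_hyp_aut:
  assumes \<alpha>: "\<alpha> > 1"
  shows "tiled_automorphism \<alpha> 0 (hyp_aut \<alpha>) ({- \<alpha> <.. - 1} \<union> {1 ..< \<alpha>}) (hyp_J \<alpha>)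
    (\<lambda>i. (1 + \<alpha>\<^sup>2) * (1 / \<alpha>) ^ i)"
proof -
  interpret disc_automorphism \<alpha> 0 "hyp_aut \<alpha>"
    by unfold_locales (use \<alpha> in \<open>auto simp: hyp_aut_def\<close>)
  let ?I = "{- \<alpha> <.. - 1} \<union> {1 ..< \<alpha>}"
  have I: "y \<in> ?I \<longleftrightarrow> 1 \<le> \<bar>y\<bar> \<and> \<bar>y\<bar> < \<alpha>" for y by auto
  have T: "T n y = \<alpha> powi n * y" for n y by (simp add: T_def)
  have \<alpha>2: "1 \<le> \<alpha>\<^sup>2" using \<alpha> by (simp add: one_le_power)
  show ?thesis
  proof unfold_locales
    show "hyp_J \<alpha> = line_pt ` ?I" by (rule hyp_J_line_pt[OF \<alpha>])
    show "?I \<in> sets borel" by simp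
    show "m = n" if "y \<in> ?I" "y' \<in> ?I" "T m y = T n y'" for m n y y'
    proof -
      have "\<bar>\<alpha> powi m * y\<bar> = \<bar>\<alpha> powi n * y'\<bar>" using that(3) by (simp add: T)
      then have "\<alpha> powi m * \<bar>y\<bar> = \<alpha> powi n * \<bar>y'\<bar>" using \<alpha> by (simp add: abs_mult)
      then have "\<not> m < n" "\<not> n < m"
        using powi_scale_not_less[OF \<alpha>] that(1,2) unfolding I by metis+
      then show "m = n" by simp
    qed
    have "\<exists>n. \<exists>y\<in>?I. x = T n y" if "x \<noteq> 0" for x
    proof -
      obtain n where n: "\<alpha> powi n \<le> \<bar>x\<bar>" "\<bar>x\<bar> < \<alpha> powi (n + 1)"
        using powi_scale_exists[OF \<alpha>, of "\<bar>x\<bar>"] \<open>x \<noteq> 0\<close> by auto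
      have p: "\<alpha> powi n > 0" using \<alpha> by simp
      have "x / \<alpha> powi n \<in> ?I"
        unfolding I using n p \<alpha> by (simp add: abs_divide pos_le_divide_eq pos_divide_less_eq power_int_add mult.commute)
      moreover have "x = T n (x / \<alpha> powi n)" using p \<alpha> by (simp add: T)
      ultimately show ?thesis by blast
    qed
    moreover have "AE x in lebesgue. x \<noteq> (0 :: real)"
      using AE_lborel_singleton[of 0] by (rule AE_completion)
    ultimately show "AE x in lebesgue. \<exists>n. \<exists>y\<in>?I. x = T n y" by (auto elim: eventually_mono)
    show "summable (\<lambda>i. (1 + \<alpha>\<^sup>2) * (1 / \<alpha>) ^ i)"
      using \<alpha> by (intro summable_mult summable_geometric) simp
  next
    fix i y assume y: "y \<in> ?I"
    define A where "A = \<alpha> ^ i"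
    have A: "A \<ge> 1" using \<alpha> by (simp add: A_def one_le_power)
    have y2: "1 \<le> y\<^sup>2" "y\<^sup>2 \<le> \<alpha>\<^sup>2"
      using y abs_le_square_iff[of 1 y] abs_le_square_iff[of y \<alpha>] \<alpha> unfolding I by auto
    have p: "1 + y\<^sup>2 > 0" "1 + A\<^sup>2 * y\<^sup>2 > 0" by (simp_all add: add_pos_nonneg)
    have rhs: "(1 + \<alpha>\<^sup>2) * (1 / \<alpha>) ^ i * line_wt y = (1 + \<alpha>\<^sup>2) * 2 / (A * (1 + y\<^sup>2))"
      by (simp add: line_wt_def A_def power_one_over field_simps)
    show "\<alpha> powi int i * line_wt (T (int i) y) \<le> (1 + \<alpha>\<^sup>2) * (1 / \<alpha>) ^ i * line_wt y"
    proof -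
      have "A\<^sup>2 * (1 + y\<^sup>2) \<le> 2 * (A\<^sup>2 * y\<^sup>2)"
        using mult_left_mono[OF y2(1), of "A\<^sup>2"] by (simp add: algebra_simps)
      also have "\<dots> \<le> (1 + \<alpha>\<^sup>2) * (1 + A\<^sup>2 * y\<^sup>2)" using \<alpha>2 by (intro mult_mono) auto
      finally have "A / (1 + A\<^sup>2 * y\<^sup>2) \<le> (1 + \<alpha>\<^sup>2) / (A * (1 + y\<^sup>2))"
        using A p by (simp add: divide_simps) (simp add: power2_eq_square algebra_simps)
      then have "A * (2 / (1 + (A * y)\<^sup>2)) \<le> (1 + \<alpha>\<^sup>2) * 2 / (A * (1 + y\<^sup>2))"
        unfolding power_mult_distrib times_divide_eq_right
        by (simp only: mult.commute[of _ 2] times_divide_eq_right [symmetric])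
      then show ?thesis unfolding rhs by (simp add: T line_wt_def A_def)
    qed
    show "\<alpha> powi (- 1 - int i) * line_wt (T (- 1 - int i) y) \<le> (1 + \<alpha>\<^sup>2) * (1 / \<alpha>) ^ i * line_wt y"
    proof -
      define B where "B = \<alpha> powi (- 1 - int i)"
      have "B = 1 / (\<alpha> * A)"
        using \<alpha> unfolding B_def A_def by (simp add: power_int_diff power_int_minus field_simps)
      moreover have "1 / (\<alpha> * A) \<le> 1 / A"
        using \<alpha> A by (intro divide_left_mono) auto
      ultimately have B: "B > 0" "B \<le> 1 / A" using \<alpha> A by simp_all
      have "B * line_wt (B * y) \<le> B * 2"
        using B by (intro mult_left_mono) (auto simp: line_wt_def pos_divide_le_eq add_pos_nonneg)
      also have "\<dots> \<le> 1 / A * 2" using B by simp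
      also have "\<dots> \<le> (1 + \<alpha>\<^sup>2) * 2 / (A * (1 + y\<^sup>2))"
        using A p y2 by (simp add: divide_simps)
      finally show ?thesis unfolding rhs by (simp add: T B_def)
    qed
  qed
qed

lemma line_wt_comparison:
  assumes "\<bar>c\<bar> \<le> \<bar>s\<bar>" "\<bar>y\<bar> \<le> \<bar>t\<bar>"
  shows "line_wt s \<le> (1 + t\<^sup>2) / (1 + c\<^sup>2) * line_wt y"
proof -
  have "c\<^sup>2 \<le> s\<^sup>2" "y\<^sup>2 \<le> t\<^sup>2" using assms by (simp_all add: abs_le_square_iff)
  then have "(1 + c\<^sup>2) * (1 + y\<^sup>2) \<le> (1 + s\<^sup>2) * (1 + t\<^sup>2)" by (intro mult_mono) auto
  moreover have "1 + c\<^sup>2 > 0" "1 + s\<^sup>2 > 0" "1 + y\<^sup>2 > 0" by (simp_all add: add_pos_nonneg)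
  ultimately show ?thesis by (simp add: line_wt_def divide_simps) (simp add: algebra_simps)
qed

text \<open>
  Both the translate of \<open>[0, t)\<close> by \<open>i t\<close> and the one by \<open>-(i + 1) t\<close> stay at distance at least \<open>i t\<close> from
  the origin, which gives quadratic decay.
\<close>

lemma tiled_par_aut:
  assumes t: "t > 0"
  shows "tiled_automorphism 1 t (par_aut t) {0 ..< t} (par_J t) (\<lambda>i. (1 + t\<^sup>2) / (1 + (real i * t)\<^sup>2))"
proof -
  interpret disc_automorphism 1 t "par_aut t"
    by unfold_locales (auto simp: par_aut_def)
  have T: "T n y = y + of_int n * t" for n y by (simp add: T_def)
  show ?thesis
  proof unfold_locales
    show "par_J t = line_pt ` {0 ..< t}" by (rule par_J_line_pt[OF t])
    show "{0 ..< t} \<in> sets borel" by simp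
    show "m = n" if "y \<in> {0 ..< t}" "y' \<in> {0 ..< t}" "T m y = T n y'" for m n y y'
    proof -
      have "\<lfloor>T k z / t\<rfloor> = k" if "z \<in> {0 ..< t}" for k z
        using that t by (simp add: T add_divide_distrib floor_unique)
      then show ?thesis using that by metis
    qed
    have "\<exists>n. \<exists>y\<in>{0 ..< t}. x = T n y" for x
    proof (intro exI bexI)
      show "x = T \<lfloor>x / t\<rfloor> (x - of_int \<lfloor>x / t\<rfloor> * t)" by (simp add: T)
      show "x - of_int \<lfloor>x / t\<rfloor> * t \<in> {0 ..< t}"
        using floor_divide_lower[OF t, of x] floor_divide_upper[OF t, of x] by (simp add: algebra_simps)
    qed
    then show "AE x in lebesgue. \<exists>n. \<exists>y\<in>{0 ..< t}. x = T n y" by simp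
    have "summable (\<lambda>i. (1 + t\<^sup>2) / t\<^sup>2 * inverse (real i ^ 2))"
      by (intro summable_mult inverse_power_summable) simp
    then show "summable (\<lambda>i. (1 + t\<^sup>2) / (1 + (real i * t)\<^sup>2))"
    proof (rule summable_comparison_test'[where N = 1])
      fix i :: nat assume "1 \<le> i"
      then have "(real i * t)\<^sup>2 > 0" using t by simp
      then have "(1 + t\<^sup>2) / (1 + (real i * t)\<^sup>2) \<le> (1 + t\<^sup>2) / (real i * t)\<^sup>2"
        by (intro divide_left_mono mult_pos_pos) (auto simp: add_pos_pos)
      then show "norm ((1 + t\<^sup>2) / (1 + (real i * t)\<^sup>2)) \<le> (1 + t\<^sup>2) / t\<^sup>2 * inverse (real i ^ 2)"
        by (simp add: power_mult_distrib divide_inverse mult.commute mult.left_commute)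
    qed
  next
    fix i y assume y: "y \<in> {0 ..< t}"
    have it: "real i * t \<ge> 0" using t by simp
    show "1 powi int i * line_wt (T (int i) y) \<le> (1 + t\<^sup>2) / (1 + (real i * t)\<^sup>2) * line_wt y"
      using y t it line_wt_comparison[of "real i * t" "T (int i) y" y t] by (simp add: T)
    have "T (- 1 - int i) y = y - t - real i * t" by (simp add: T algebra_simps)
    then have "\<bar>real i * t\<bar> \<le> \<bar>T (- 1 - int i) y\<bar>"
      using y it unfolding atLeastLessThan_iff by linarith
    then show "1 powi (- 1 - int i) * line_wt (T (- 1 - int i) y) \<le> (1 + t\<^sup>2) / (1 + (real i * t)\<^sup>2) * line_wt y"
      using y t line_wt_comparison[of "real i * t" "T (- 1 - int i) y" y t] by simp
  qed
qed

theorem mainTheorem5: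
  fixes \<phi> :: "complex \<Rightarrow> complex" and J :: "complex set" and lam :: real
  assumes "(\<exists>\<alpha>>1. \<phi> = hyp_aut \<alpha> \<and> J = hyp_J \<alpha>) \<or>
           (\<exists>t>0. \<phi> = par_aut t \<and> J = par_J t)"
    and "lam > 0"
  shows "((\<exists>f F. is_outer f F \<and> eigen_mod \<phi> lam F) \<longleftrightarrow> lam = 1) \<and>
         (lam = 1 \<longrightarrow>
           (\<forall>f F. is_outer f F \<longrightarrow>
              (eigen_mod \<phi> lam F \<longleftrightarrow>
               (\<exists>f0. weight_on J f0 \<and> (AE z in arc_length. f z = spread \<phi> J f0 z)))) \<and>
           (\<forall>f0. weight_on J f0 \<longrightarrow> (\<exists>F. is_outer (spread \<phi> J f0) F)))"
  using assms(1)
proof (elim disjE exE conjE)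
  fix \<alpha> :: real assume "\<alpha> > 1" and "\<phi> = hyp_aut \<alpha>" "J = hyp_J \<alpha>"
  then show ?thesis
    using tiled_automorphism.eigen_characterization[OF tiled_hyp_aut \<open>lam > 0\<close>] by simp
next
  fix t :: real assume "t > 0" and "\<phi> = par_aut t" "J = par_J t"
  then show ?thesis
    using tiled_automorphism.eigen_characterization[OF tiled_par_aut \<open>lam > 0\<close>] by simp
qed

end
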